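(* Let $(X_1,\|\cdot\|_1),\dots,(X_n,\|\cdot\|_n)$ be finite dimensional real normed linear spaces, let $X=X_1\times\cdots\times X_n$ carry the product norm $\|\cdot\|_\pi$, and let $(G,p)$ be a well-positioned bar-joint framework in $(X,\|\cdot\|_\pi)$, with projected monochrome subframeworks $(G_j,p_j)$, $j=1,\dots,n$. Then the following are equivalent: (i) $(G,p)$ is infinitesimally rigid in $(X,\|\cdot\|_\pi)$; (ii) $(G_j,p_j)$ is infinitesimally rigid in $(X_j,\|\cdot\|_j)$ for each $j=1,\dots,n$. Moreover the equivalence also holds with "infinitesimally rigid" replaced by "minimally infinitesimally rigid" in both (i) and (ii).
   Context: Product norm: $\|x\|_\pi=\max_{j}\|x_j\|_j$ for $x=(x_1,\dots,x_n)\in X$; $P_j:X\to X_j$ is the projection $x\mapsto x_j$. Frameworks. $G=(V,E)$ is a finite simple graph. A bar-joint framework $(G,p)$ in a real normed space $X$ is $G$ with a map $p:V\to X$, $v\mapsto p_v$, such that $p_v\ne p_w$ for all $vw\in E$. A support functional for a unit vector $x_0\in X$ is a linear functional $f:X\to\mathbb{R}$ with $\|f\|\le1$ and $f(x_0)=1$; the norm is smooth at $x\neq0$ if $x/\|x\|$ has exactly one support functional. $(G,p)$ is well-positioned if the norm is smooth at $p_v-p_w$ for every $vw\in E$. A rigid motion of $(X,\|\cdot\|)$ is a family of continuous paths $\{\alpha_x:[-1,1]\to X\}_{x\in X}$ with $\alpha_x(0)=x$, $\alpha_x$ differentiable at $0$, and $\|\alpha_x(t)-\alpha_y(t)\|=\|x-y\|$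 for all $x,y\in X$, $t\in[-1,1]$. $\mathcal{T}(X,\|\cdot\|)$ is the space of maps $\eta:X\to X$ of the form $\eta(x)=\alpha_x'(0)$. With $f_G:X^V\to\mathbb{R}^E$, $f_G((x_v)_v)=(\|x_v-x_w\|)_{vw\in E}$, an infinitesimal flex of $(G,p)$ is $z\in X^V$ with $\lim_{t\to0}\frac1t(f_G(p+tz)-f_G(p))=0$; it is trivial if $z=\eta\circ p$ for some $\eta\in\mathcal{T}(X,\|\cdot\|)$. $(G,p)$ is infinitesimally rigid if every infinitesimal flex is trivial, and infinitesimally flexible otherwise. It is minimally infinitesimally rigid if it is infinitesimally rigid and every subframework obtained by removing an edge from $G$ (keeping all vertices and their positions) is infinitesimally flexible. Framework colours. For $(G,p)$ in $(X,\|\cdot\|_\pi)$, an edge $vw\in E$ has framework colour $j$ if $\|p_v-p_w\|_\pi=\|P_j(p_v-p_w)\|_j$. $E_j$ is the set of edges with framework colour $j$, $G_j=(V,E_j)$ is the monochrome subgraph (on the full vertex set $V$), and $p_j=P_j\circ p:V\to X_j$. Then $(G_j,p_j)$ is a bar-joint framework in $X_j$, called the projected monochrome subframework with framework colour $j$. *)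

theory Defs
  imports "HOL-Analysis.Analysis"
begin

text \<open>
  A normed space is a pair of a carrier \<open>S\<close>, a linear subspace of an ambient real vector space,
  and a function \<open>N\<close> whose restriction to \<open>S\<close> is a norm; values of \<open>N\<close> off \<open>S\<close> are
  irrelevant. Any finite family of real vector spaces embeds into one ambient space (their direct
  sum), so a single ambient type allows factors of unrelated dimensions and with unrelated norms.
  The norm-type-class is not used because the norm varies with the factor.
\<close>

definition normed_space_on :: "'a::real_vector set \<Rightarrow> ('a \<Rightarrow> real) \<Rightarrow> bool" where
  "normed_space_on S N \<longleftrightarrow>
     subspace S \<and>
     (\<forall>x\<in>S. 0 \<le> N x) \<and>
     (\<forall>x\<in>S. N x = 0 \<longleftrightarrow> x = 0) \<and>
     (\<forall>c. \<forall>x\<in>S. N (c *\<^sub>R x) = \<bar>c\<bar> * N x) \<and>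
     (\<forall>x\<in>S. \<forall>y\<in>S. N (x + y) \<le> N x + N y)"

definition finite_dim_normed_space_on :: "'a::real_vector set \<Rightarrow> ('a \<Rightarrow> real) \<Rightarrow> bool" where
  "finite_dim_normed_space_on S N \<longleftrightarrow>
     normed_space_on S N \<and> (\<exists>B. finite B \<and> span B = S)"

definition norm_tendsto :: "('a::real_vector \<Rightarrow> real) \<Rightarrow> ('b \<Rightarrow> 'a) \<Rightarrow> 'a \<Rightarrow> 'b filter \<Rightarrow> bool" where
  "norm_tendsto N f l F \<longleftrightarrow> ((\<lambda>t. N (f t - l)) \<longlongrightarrow> 0) F"


subsection \<open>Product spaces\<close>

definition prod_carrier :: "('n::finite \<Rightarrow> 'a::real_vector set) \<Rightarrow> ('a ^ 'n) set" where
  "prod_carrier S = {x. \<forall>j. x $ j \<in> S j}"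

definition prod_norm :: "('n::finite \<Rightarrow> 'a::real_vector \<Rightarrow> real) \<Rightarrow> 'a ^ 'n \<Rightarrow> real" where
  "prod_norm N x = (MAX j. N j (x $ j))"


subsection \<open>Support functionals and smoothness\<close>

text \<open>
  Functionals on \<open>S\<close> are made extensional, so that uniqueness of a functional means uniqueness of
  its values on \<open>S\<close>. The third conjunct says that the operator norm is at most 1.
\<close>

definition support_functional ::
  "'a::real_vector set \<Rightarrow> ('a \<Rightarrow> real) \<Rightarrow> 'a \<Rightarrow> ('a \<Rightarrow> real) \<Rightarrow> bool" where
  "support_functional S N x0 f \<longleftrightarrow>
     f \<in> extensional S \<and>
     (\<forall>a b. \<forall>x\<in>S. \<forall>y\<in>S. f (a *\<^sub>R x + b *\<^sub>R y) = a * f x + b * f y) \<and>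
     (\<forall>x\<in>S. \<bar>f x\<bar> \<le> N x) \<and>
     f x0 = 1"

definition smooth_norm_at :: "'a::real_vector set \<Rightarrow> ('a \<Rightarrow> real) \<Rightarrow> 'a \<Rightarrow> bool" where
  "smooth_norm_at S N x \<longleftrightarrow>
     x \<in> S \<and> x \<noteq> 0 \<and> (\<exists>!f. support_functional S N ((1 / N x) *\<^sub>R x) f)"


subsection \<open>Frameworks\<close>

definition finite_simple_graph :: "'v set \<Rightarrow> 'v set set \<Rightarrow> bool" where
  "finite_simple_graph V E \<longleftrightarrow> finite V \<and> (\<forall>e\<in>E. e \<subseteq> V \<and> card e = 2)"

definition bar_joint_framework ::
  "'a::real_vector set \<Rightarrow> 'v set \<Rightarrow> 'v set set \<Rightarrow> ('v \<Rightarrow> 'a) \<Rightarrow> bool" where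
  "bar_joint_framework S V E p \<longleftrightarrow>
     finite_simple_graph V E \<and> (\<forall>v\<in>V. p v \<in> S) \<and> (\<forall>v w. {v, w} \<in> E \<longrightarrow> p v \<noteq> p w)"

definition well_positioned ::
  "'a::real_vector set \<Rightarrow> ('a \<Rightarrow> real) \<Rightarrow> 'v set set \<Rightarrow> ('v \<Rightarrow> 'a) \<Rightarrow> bool" where
  "well_positioned S N E p \<longleftrightarrow> (\<forall>v w. {v, w} \<in> E \<longrightarrow> smooth_norm_at S N (p v - p w))"


subsection \<open>Rigid motions and infinitesimal rigidity\<close>

text \<open>
  \<open>rigid_motion S N \<alpha> \<eta>\<close>: \<open>\<alpha>\<close> is a rigid motion of \<open>(S, N)\<close>, and \<open>\<eta> x\<close> is the derivative at 0 of
  the path \<open>\<alpha> x\<close>. Only the values of \<open>\<alpha>\<close> on \<open>S \<times> [-1, 1]\<close> and of \<open>\<eta>\<close> on \<open>S\<close> matter.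
\<close>

definition rigid_motion ::
  "'a::real_vector set \<Rightarrow> ('a \<Rightarrow> real) \<Rightarrow> ('a \<Rightarrow> real \<Rightarrow> 'a) \<Rightarrow> ('a \<Rightarrow> 'a) \<Rightarrow> bool" where
  "rigid_motion S N \<alpha> \<eta> \<longleftrightarrow>
     (\<forall>x\<in>S. \<forall>t\<in>{-1..1}. \<alpha> x t \<in> S) \<and>
     (\<forall>x\<in>S. \<forall>t\<in>{-1..1}. norm_tendsto N (\<alpha> x) (\<alpha> x t) (at t within {-1..1})) \<and>
     (\<forall>x\<in>S. \<alpha> x 0 = x) \<and>
     (\<forall>x\<in>S. \<eta> x \<in> S \<and> norm_tendsto N (\<lambda>t. (1 / t) *\<^sub>R (\<alpha> x t - \<alpha> x 0)) (\<eta> x) (at 0)) \<and>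
     (\<forall>x\<in>S. \<forall>y\<in>S. \<forall>t\<in>{-1..1}. N (\<alpha> x t - \<alpha> y t) = N (x - y))"

definition infinitesimal_rigid_motions ::
  "'a::real_vector set \<Rightarrow> ('a \<Rightarrow> real) \<Rightarrow> ('a \<Rightarrow> 'a) set" where
  "infinitesimal_rigid_motions S N = {\<eta>. \<exists>\<alpha>. rigid_motion S N \<alpha> \<eta>}"

text \<open>As \<open>E\<close> is finite, the limit in \<open>\<real>\<^sup>E\<close> defining a flex is taken edge by edge.\<close>

definition infinitesimal_flex ::
  "'a::real_vector set \<Rightarrow> ('a \<Rightarrow> real) \<Rightarrow> 'v set \<Rightarrow> 'v set set \<Rightarrow> ('v \<Rightarrow> 'a) \<Rightarrow> ('v \<Rightarrow> 'a) \<Rightarrow> bool"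
where
  "infinitesimal_flex S N V E p z \<longleftrightarrow>
     (\<forall>v\<in>V. z v \<in> S) \<and>
     (\<forall>v w. {v, w} \<in> E \<longrightarrow>
       ((\<lambda>t. (1 / t) * (N ((p v + t *\<^sub>R z v) - (p w + t *\<^sub>R z w)) - N (p v - p w))) \<longlongrightarrow> 0) (at 0))"

definition trivial_flex ::
  "'a::real_vector set \<Rightarrow> ('a \<Rightarrow> real) \<Rightarrow> 'v set \<Rightarrow> ('v \<Rightarrow> 'a) \<Rightarrow> ('v \<Rightarrow> 'a) \<Rightarrow> bool" where
  "trivial_flex S N V p z \<longleftrightarrow>
     (\<exists>\<eta>\<in>infinitesimal_rigid_motions S N. \<forall>v\<in>V. z v = \<eta> (p v))"

definition infinitesimally_rigid ::
  "'a::real_vector set \<Rightarrow> ('a \<Rightarrow> real) \<Rightarrow> 'v set \<Rightarrow> 'v set set \<Rightarrow> ('v \<Rightarrow> 'a) \<Rightarrow> bool" where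
  "infinitesimally_rigid S N V E p \<longleftrightarrow>
     (\<forall>z. infinitesimal_flex S N V E p z \<longrightarrow> trivial_flex S N V p z)"

definition minimally_infinitesimally_rigid ::
  "'a::real_vector set \<Rightarrow> ('a \<Rightarrow> real) \<Rightarrow> 'v set \<Rightarrow> 'v set set \<Rightarrow> ('v \<Rightarrow> 'a) \<Rightarrow> bool" where
  "minimally_infinitesimally_rigid S N V E p \<longleftrightarrow>
     infinitesimally_rigid S N V E p \<and> (\<forall>e\<in>E. \<not> infinitesimally_rigid S N V (E - {e}) p)"


subsection \<open>Framework colours\<close>

definition colour_edges ::
  "('n::finite \<Rightarrow> 'a::real_vector \<Rightarrow> real) \<Rightarrow> 'v set set \<Rightarrow> ('v \<Rightarrow> 'a ^ 'n) \<Rightarrow> 'n \<Rightarrow> 'v set set" where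
  "colour_edges N E p j =
     {{v, w} | v w. {v, w} \<in> E \<and> prod_norm N (p v - p w) = N j ((p v - p w) $ j)}"

definition proj_placement :: "('v \<Rightarrow> 'a ^ 'n) \<Rightarrow> 'n \<Rightarrow> 'v \<Rightarrow> 'a" where
  "proj_placement p j v = p v $ j"


subsection \<open>The product norm and the projected monochrome subframeworks are well defined\<close>

lemma prod_norm_ge: "N j (x $ j) \<le> prod_norm N x"
  unfolding prod_norm_def by (rule Max_ge) auto

lemma prod_norm_attained: "\<exists>j. prod_norm N x = N j (x $ j)"
proof -
  have "prod_norm N x \<in> range (\<lambda>j. N j (x $ j))"
    unfolding prod_norm_def by (rule Max_in) auto
  then show ?thesis by auto
qed

lemma normed_space_on_prod:
  assumes "\<And>j. normed_space_on (S j) (N j)"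
  shows "normed_space_on (prod_carrier S) (prod_norm N)"
  unfolding normed_space_on_def
proof (intro conjI ballI allI)
  have sub: "subspace (S j)" for j
    using assms[of j] by (simp add: normed_space_on_def)
  have nonneg: "0 \<le> N j a" if "a \<in> S j" for j a
    using assms[of j] that by (simp add: normed_space_on_def)
  have eq0: "N j a = 0 \<longleftrightarrow> a = 0" if "a \<in> S j" for j a
    using assms[of j] that by (simp add: normed_space_on_def)
  have scale: "N j (c *\<^sub>R a) = \<bar>c\<bar> * N j a" if "a \<in> S j" for j a c
    using assms[of j] that by (simp add: normed_space_on_def)
  have tri: "N j (a + b) \<le> N j a + N j b" if "a \<in> S j" "b \<in> S j" for j a b
    using assms[of j] that by (simp add: normed_space_on_def)
  show "subspace (prod_carrier S)"
    by (rule subspaceI)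
      (simp_all add: prod_carrier_def subspace_0[OF sub] subspace_add[OF sub] subspace_scale[OF sub])
  fix x assume x: "x \<in> prod_carrier S"
  then have xj: "x $ j \<in> S j" for j by (simp add: prod_carrier_def)
  show "0 \<le> prod_norm N x"
    using order_trans[OF nonneg[OF xj[of undefined]] prod_norm_ge[of N undefined x]] .
  show "prod_norm N x = 0 \<longleftrightarrow> x = 0"
  proof
    assume "prod_norm N x = 0"
    then have "N j (x $ j) = 0" for j
      using prod_norm_ge[of N j x] nonneg[OF xj[of j]] by simp
    then show "x = 0" using eq0[OF xj] by (simp add: vec_eq_iff)
  next
    assume "x = 0"
    obtain j where "prod_norm N x = N j (x $ j)" using prod_norm_attained by blast
    then show "prod_norm N x = 0" using eq0[OF xj[of j]] \<open>x = 0\<close> by simp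
  qed
  show "prod_norm N (c *\<^sub>R x) = \<bar>c\<bar> * prod_norm N x" for c
  proof (rule antisym)
    obtain j where "prod_norm N (c *\<^sub>R x) = N j ((c *\<^sub>R x) $ j)"
      using prod_norm_attained by blast
    then have "prod_norm N (c *\<^sub>R x) = \<bar>c\<bar> * N j (x $ j)" by (simp add: scale[OF xj])
    then show "prod_norm N (c *\<^sub>R x) \<le> \<bar>c\<bar> * prod_norm N x"
      by (simp add: mult_left_mono prod_norm_ge)
  next
    obtain j where "prod_norm N x = N j (x $ j)" using prod_norm_attained by blast
    then have "\<bar>c\<bar> * prod_norm N x = N j ((c *\<^sub>R x) $ j)" by (simp add: scale[OF xj])
    then show "\<bar>c\<bar> * prod_norm N x \<le> prod_norm N (c *\<^sub>R x)" by (simp only: prod_norm_ge)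
  qed
  fix y assume "y \<in> prod_carrier S"
  then have yj: "y $ j \<in> S j" for j by (simp add: prod_carrier_def)
  obtain j where "prod_norm N (x + y) = N j ((x + y) $ j)" using prod_norm_attained by blast
  then have "prod_norm N (x + y) \<le> N j (x $ j) + N j (y $ j)" using tri[OF xj yj] by simp
  also have "\<dots> \<le> prod_norm N x + prod_norm N y" by (intro add_mono prod_norm_ge)
  finally show "prod_norm N (x + y) \<le> prod_norm N x + prod_norm N y" .
qed

lemma bar_joint_framework_colour:
  assumes N: "\<And>j. normed_space_on (S j) (N j)"
    and F: "bar_joint_framework (prod_carrier S) V E p"
  shows "bar_joint_framework (S j) V (colour_edges N E p j) (proj_placement p j)"
proof -
  have V: "p v \<in> prod_carrier S" if "v \<in> V" for v
    using F that by (simp add: bar_joint_framework_def)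
  have G: "finite V" "\<And>e. e \<in> E \<Longrightarrow> e \<subseteq> V \<and> card e = 2"
    using F by (simp_all add: bar_joint_framework_def finite_simple_graph_def)
  have ne: "p v \<noteq> p w" if "{v, w} \<in> E" for v w
    using F that by (simp add: bar_joint_framework_def)
  have P: "subspace (prod_carrier S)" "\<And>x. x \<in> prod_carrier S \<Longrightarrow> prod_norm N x = 0 \<Longrightarrow> x = 0"
    using normed_space_on_prod[of S N, OF N] by (simp_all add: normed_space_on_def)
  have "N j 0 = 0"
    using N[of j] subspace_0 by (auto simp: normed_space_on_def)
  have key: "p v $ j \<noteq> p w $ j"
    if e: "{v, w} \<in> E" and c: "prod_norm N (p v - p w) = N j ((p v - p w) $ j)" for v w
  proof
    assume "p v $ j = p w $ j"
    then have "prod_norm N (p v - p w) = 0" using c \<open>N j 0 = 0\<close> by simp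
    moreover have "p v - p w \<in> prod_carrier S"
      using G(2)[OF e] by (intro subspace_diff[OF P(1)] V) auto
    ultimately have "p v - p w = 0" using P(2) by blast
    then show False using ne[OF e] by simp
  qed
  have "colour_edges N E p j \<subseteq> E" unfolding colour_edges_def by blast
  then have "finite_simple_graph V (colour_edges N E p j)"
    using G unfolding finite_simple_graph_def by blast
  moreover have "proj_placement p j v \<in> S j" if "v \<in> V" for v
    using V[OF that] by (simp add: prod_carrier_def proj_placement_def)
  moreover have "proj_placement p j v \<noteq> proj_placement p j w"
    if vw: "{v, w} \<in> colour_edges N E p j" for v w
  proof -
    obtain a b where "{v, w} = {a, b}" and "{a, b} \<in> E"
      and "prod_norm N (p a - p b) = N j ((p a - p b) $ j)"
      using vw unfolding colour_edges_def by blast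
    with key[of a b] show ?thesis
      unfolding proj_placement_def doubleton_eq_iff by metis
  qed
  ultimately show ?thesis unfolding bar_joint_framework_def by blast
qed

end

theory Submission
  imports Defs
begin

text \<open>
  Two facts about the product norm carry the proof: locally it is the norm of a single factor, and
  its infinitesimal rigid motions are exactly the products of infinitesimal rigid motions of the
  factors.

  Flexes. A smooth point \<open>u\<close> of the product norm has exactly one component of maximal norm: if the
  components \<open>j\<close> and \<open>k\<close> both attained the maximum, then support functionals of the factors
  (Hahn-Banach) at \<open>u $ j\<close> and \<open>u $ k\<close>, composed with the projections, would be two different
  support functionals at \<open>u / \<parallel>u\<parallel>\<close>. Hence every edge has exactly one colour \<open>j\<close>, near \<open>p\<close> its length
  is computed in the factor \<open>j\<close> alone, and \<open>z\<close> is a flex of the framework if and only if each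
  component of \<open>z\<close> is a flex of the corresponding monochrome subframework
  (\<open>infinitesimal_flex_iff\<close>).

  Motions. Rigid motions of the factors clearly combine. The converse
  (\<open>infinitesimal_rigid_motion_components\<close>) is the main point. For a rigid motion \<open>\<alpha>\<close> of a
  finite-dimensional space, each map \<open>x \<mapsto> \<alpha> x t\<close> is an isometry. By compactness it is surjective,
  so by the Mazur-Ulam theorem it is affine. As its linear part tends pointwise to the identity when
  \<open>t \<rightarrow> 0\<close>, compactness of the unit sphere makes this uniform: for small \<open>t\<close> the linear part is within
  \<open>1/2\<close> of the identity (\<open>rigid_motion_near_identity\<close>). Such an isometry of the product cannot mix
  the factors: if one component of \<open>x - y\<close> is more than twice as long as all the others, it stays the
  longest one and so keeps its length. Comparing with far away points then shows that the \<open>j\<close>-th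
  component of \<open>\<alpha> x t\<close> depends on the \<open>j\<close>-th component of \<open>x\<close> only, and isometrically so
  (\<open>component_dependence\<close>, \<open>component_isometry\<close>). This yields a rigid motion of the factor \<open>j\<close> for
  small times, which is extended by stopping it.

  The equivalence for rigidity follows by comparing flexes and motions component by component, and
  the one for minimal rigidity because the removal of an edge affects only the subgraph of its own
  colour.
\<close>

section \<open>Normed carriers\<close>

locale normed_carrier =
  fixes S :: "'a::real_vector set" and N :: "'a \<Rightarrow> real"
  assumes normed: "normed_space_on S N"
begin

lemma subspace_carrier: "subspace S"
  using normed by (simp add: normed_space_on_def)

lemma carrier_closed [simp, intro]:
  "0 \<in> S"
  "x \<in> S \<Longrightarrow> y \<in> S \<Longrightarrow> x + y \<in> S"
  "x \<in> S \<Longrightarrow> y \<in> S \<Longrightarrow> x - y \<in> S"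
  "x \<in> S \<Longrightarrow> c *\<^sub>R x \<in> S"
  "x \<in> S \<Longrightarrow> - x \<in> S"
  using subspace_carrier
  by (auto intro: subspace_0 subspace_add subspace_diff subspace_scale subspace_neg)

lemma norm_nonneg: "x \<in> S \<Longrightarrow> 0 \<le> N x"
  and norm_eq_0: "x \<in> S \<Longrightarrow> N x = 0 \<longleftrightarrow> x = 0"
  and norm_scale: "x \<in> S \<Longrightarrow> N (c *\<^sub>R x) = \<bar>c\<bar> * N x"
  and norm_triangle: "x \<in> S \<Longrightarrow> y \<in> S \<Longrightarrow> N (x + y) \<le> N x + N y"
  using normed by (simp_all add: normed_space_on_def)

lemma norm_zero [simp]: "N 0 = 0"
  by (simp add: norm_eq_0)

lemma norm_minus: "x \<in> S \<Longrightarrow> N (- x) = N x"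
  using norm_scale[of x "-1"] by simp

lemma norm_diff_commute: "x \<in> S \<Longrightarrow> y \<in> S \<Longrightarrow> N (x - y) = N (y - x)"
  using norm_minus[of "x - y"] by simp

lemma norm_diff_triangle:
  assumes "x \<in> S" "y \<in> S" "z \<in> S"
  shows "N (x - z) \<le> N (x - y) + N (y - z)"
  using norm_triangle[of "x - y" "y - z"] assms by simp

lemma norm_triangle_diff: "x \<in> S \<Longrightarrow> y \<in> S \<Longrightarrow> N (x - y) \<le> N x + N y"
  using norm_triangle[of x "- y"] by (simp add: norm_minus)

lemma norm_reverse_triangle: "x \<in> S \<Longrightarrow> y \<in> S \<Longrightarrow> N x - N y \<le> N (x + y)"
  using norm_triangle_diff[of "x + y" y] by simp

lemma span_subset_carrier: "B \<subseteq> S \<Longrightarrow> span B \<subseteq> S"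
  by (rule span_minimal[OF _ subspace_carrier])

text \<open>
  Bolzano-Weierstrass for the given norm, by induction over a spanning set: the hypothesis for
  \<open>span B\<close> makes \<open>span B\<close> closed, so a new direction \<open>b\<close> has positive distance from it, and
  this distance controls the coefficient of \<open>b\<close>.
\<close>
lemma bounded_sequence_convergent_subsequence:
  fixes X :: "nat \<Rightarrow> 'a"
  assumes "finite B" "B \<subseteq> S" "\<And>n. X n \<in> span B" "\<And>n. N (X n) \<le> C"
  shows "\<exists>r l. strict_mono r \<and> l \<in> span B \<and> (\<lambda>n. N (X (r n) - l)) \<longlonglongrightarrow> 0"
  using assms
proof (induction B arbitrary: X C rule: finite_induct)
  case empty
  then have X0: "X n = 0" for n by simp
  have "strict_mono (id :: nat \<Rightarrow> nat)" "(\<lambda>n. N (X (id n) - 0)) \<longlonglongrightarrow> 0" "0 \<in> span {}"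
    by (simp_all add: strict_mono_def X0)
  then show ?case by blast
next
  case (insert b B)
  have b: "b \<in> S" and B: "B \<subseteq> S" using insert.prems by auto
  have inS: "y \<in> S" if "y \<in> span B" for y using span_subset_carrier[OF B] that by auto
  show ?case
  proof (cases "b \<in> span B")
    case True
    then have eq: "span (insert b B) = span B" by (rule span_redundant)
    show ?thesis
      using insert.IH[OF B, of X C] insert.prems(2,3) unfolding eq by blast
  next
    case False
    obtain d where d: "d > 0" "\<And>y. y \<in> span B \<Longrightarrow> d \<le> N (b - y)"
    proof (rule ccontr)
      assume no: "\<not> thesis"
      have "\<exists>y\<in>span B. N (b - y) < inverse (real (Suc n))" for n
        using no that[of "inverse (real (Suc n))"] by (meson not_le inverse_positive_iff_positive
            of_nat_0_less_iff zero_less_Suc)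
      then obtain Y where Y: "\<And>n. Y n \<in> span B" "\<And>n. N (b - Y n) < inverse (real (Suc n))"
        by metis
      have "N (Y n) \<le> N b + 1" for n
      proof -
        have "N (Y n) \<le> N b + N (b - Y n)"
          using norm_triangle_diff[of b "b - Y n"] b inS[OF Y(1)[of n]] by simp
        moreover have "inverse (real (Suc n)) \<le> 1" by (simp add: field_simps)
        ultimately show ?thesis using Y(2)[of n] by linarith
      qed
      with insert.IH[OF B, of Y] Y(1) obtain r l
        where r: "strict_mono r" and l: "l \<in> span B" and lim: "(\<lambda>n. N (Y (r n) - l)) \<longlonglongrightarrow> 0"
        by blast
      have "(\<lambda>n. inverse (real (Suc (r n)))) \<longlonglongrightarrow> 0"
        using LIMSEQ_subseq_LIMSEQ[OF LIMSEQ_inverse_real_of_nat r] by (simp add: o_def)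
      from tendsto_add[OF this lim]
      have "(\<lambda>n. inverse (real (Suc (r n))) + N (Y (r n) - l)) \<longlonglongrightarrow> 0" by simp
      moreover have "N (b - l) \<le> inverse (real (Suc (r n))) + N (Y (r n) - l)" for n
        using norm_diff_triangle[of b "Y (r n)" l] Y(2)[of "r n"] b inS[OF Y(1)] inS[OF l]
        by fastforce
      ultimately have "N (b - l) \<le> 0" by (intro LIMSEQ_le_const) auto
      then have "b = l"
        using norm_nonneg[of "b - l"] norm_eq_0[of "b - l"] b inS[OF l] by simp
      with l False show False by simp
    qed
    have "\<exists>c. X n - c *\<^sub>R b \<in> span B" for n
      using insert.prems(2)[of n] by (simp add: span_breakdown_eq)
    then obtain c where c: "\<And>n. X n - c n *\<^sub>R b \<in> span B" by metis
    have XS: "X n \<in> S" for n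
      using span_subset_carrier[OF insert.prems(1)] insert.prems(2) by blast
    have coeff: "\<bar>c n\<bar> \<le> C / d" for n
    proof (cases "c n = 0")
      case True
      then show ?thesis
        using insert.prems(3)[of n] norm_nonneg[OF XS[of n]] d(1) by simp
    next
      case False
      define y where "y = - (1 / c n) *\<^sub>R (X n - c n *\<^sub>R b)"
      have "y \<in> span B" unfolding y_def by (intro span_scale c)
      have "X n = c n *\<^sub>R (b - y)"
        using False by (simp add: y_def algebra_simps)
      then have "N (X n) = \<bar>c n\<bar> * N (b - y)"
        using norm_scale[of "b - y" "c n"] b inS[OF \<open>y \<in> span B\<close>] by simp
      moreover have "\<bar>c n\<bar> * d \<le> \<bar>c n\<bar> * N (b - y)"
        using d(2)[OF \<open>y \<in> span B\<close>] by (simp add: mult_left_mono)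
      ultimately have "\<bar>c n\<bar> * d \<le> C" using insert.prems(3)[of n] by linarith
      then show ?thesis using d(1) by (simp add: field_simps)
    qed
    then have "bounded (range c)" by (auto simp: bounded_iff)
    then obtain k r1 where r1: "strict_mono r1" "(c \<circ> r1) \<longlonglongrightarrow> k"
      using bounded_imp_convergent_subsequence by blast
    define Y where "Y n = X (r1 n) - c (r1 n) *\<^sub>R b" for n
    have Y: "Y n \<in> span B" for n unfolding Y_def by (rule c)
    have "N (Y n) \<le> C + C / d * N b" for n
    proof -
      have "N (Y n) \<le> N (X (r1 n)) + \<bar>c (r1 n)\<bar> * N b"
        using norm_triangle_diff[of "X (r1 n)" "c (r1 n) *\<^sub>R b"] XS b
        by (simp add: Y_def norm_scale)
      moreover have "\<bar>c (r1 n)\<bar> * N b \<le> C / d * N b"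
        by (intro mult_right_mono coeff norm_nonneg b)
      ultimately show ?thesis using insert.prems(3)[of "r1 n"] by linarith
    qed
    with insert.IH[OF B, of Y] Y obtain r2 l
      where r2: "strict_mono r2" and l: "l \<in> span B" and lim: "(\<lambda>n. N (Y (r2 n) - l)) \<longlonglongrightarrow> 0"
      by blast
    define r where "r = r1 \<circ> r2"
    have ck: "(\<lambda>n. c (r n)) \<longlonglongrightarrow> k"
      using LIMSEQ_subseq_LIMSEQ[OF r1(2) r2] by (simp add: r_def o_def)
    have "(\<lambda>n. N (Y (r2 n) - l) + \<bar>c (r n) - k\<bar> * N b) \<longlonglongrightarrow> 0 + \<bar>k - k\<bar> * N b"
      by (intro tendsto_intros lim ck)
    then have bnd: "(\<lambda>n. N (Y (r2 n) - l) + \<bar>c (r n) - k\<bar> * N b) \<longlonglongrightarrow> 0" by simp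
    have "N (X (r n) - (l + k *\<^sub>R b)) \<le> N (Y (r2 n) - l) + \<bar>c (r n) - k\<bar> * N b" for n
    proof -
      have eq: "X (r n) - (l + k *\<^sub>R b) = (Y (r2 n) - l) + (c (r n) - k) *\<^sub>R b"
        by (simp add: Y_def r_def algebra_simps)
      show ?thesis
        using norm_triangle[of "Y (r2 n) - l" "(c (r n) - k) *\<^sub>R b"] b inS[OF Y] inS[OF l]
        unfolding eq by (simp add: norm_scale)
    qed
    moreover have "0 \<le> N (X (r n) - (l + k *\<^sub>R b))" for n
      using XS b inS[OF l] by (intro norm_nonneg) auto
    ultimately have "(\<lambda>n. N (X (r n) - (l + k *\<^sub>R b))) \<longlonglongrightarrow> 0"
      by (intro tendsto_sandwich[OF _ _ tendsto_const bnd]) auto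
    moreover have "strict_mono r" unfolding r_def using r1(1) r2 by (rule strict_mono_o)
    moreover have "l + k *\<^sub>R b \<in> span (insert b B)"
      using l by (auto simp: span_breakdown_eq intro!: exI[of _ k])
    ultimately show ?thesis by blast
  qed
qed


end

section \<open>Isometries of a normed space: the Mazur-Ulam theorem\<close>

context normed_carrier
begin

definition surj_isometry :: "('a \<Rightarrow> 'a) \<Rightarrow> bool" where
  "surj_isometry f \<longleftrightarrow> f ` S = S \<and> (\<forall>x\<in>S. \<forall>y\<in>S. N (f x - f y) = N (x - y))"

lemma surj_isometry_in: "surj_isometry f \<Longrightarrow> x \<in> S \<Longrightarrow> f x \<in> S"
  by (auto simp: surj_isometry_def)

lemma surj_isometry_dist: "surj_isometry f \<Longrightarrow> x \<in> S \<Longrightarrow> y \<in> S \<Longrightarrow> N (f x - f y) = N (x - y)"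
  by (auto simp: surj_isometry_def)

lemma surj_isometry_comp:
  assumes "surj_isometry f" "surj_isometry g"
  shows "surj_isometry (\<lambda>x. f (g x))"
proof -
  have "(\<lambda>x. f (g x)) ` S = f ` g ` S" by auto
  also have "\<dots> = S" using assms by (simp add: surj_isometry_def)
  finally show ?thesis
    using surj_isometry_in[OF assms(2)] surj_isometry_dist[OF assms(1)]
      surj_isometry_dist[OF assms(2)] by (simp add: surj_isometry_def)
qed

lemma surj_isometry_inj: "surj_isometry f \<Longrightarrow> inj_on f S"
  by (rule inj_onI) (metis carrier_closed(3) norm_eq_0 right_minus_eq surj_isometry_dist norm_zero)

lemma surj_isometry_inv:
  assumes "surj_isometry f"
  shows "surj_isometry (inv_into S f)"
proof -
  have im: "f ` S = S" using assms by (simp add: surj_isometry_def)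
  have "bij_betw f S S" using surj_isometry_inj[OF assms] im by (simp add: bij_betw_def)
  then have "inv_into S f ` S = S" by (metis bij_betw_def bij_betw_inv_into)
  moreover have "N (inv_into S f x - inv_into S f y) = N (x - y)" if "x \<in> S" "y \<in> S" for x y
    using surj_isometry_dist[OF assms, of "inv_into S f x" "inv_into S f y"] that im
    by (metis f_inv_into_f inv_into_into)
  ultimately show ?thesis by (simp add: surj_isometry_def)
qed

lemma surj_isometry_reflection:
  assumes "s \<in> S"
  shows "surj_isometry (\<lambda>x. s - x)"
  unfolding surj_isometry_def
proof (intro conjI ballI)
  have "y \<in> (\<lambda>x. s - x) ` S" if "y \<in> S" for y
    using that assms by (intro image_eqI[of _ _ "s - y"]) auto
  then show "(\<lambda>x. s - x) ` S = S" using assms by auto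
  show "N (s - x - (s - y)) = N (x - y)" if "x \<in> S" "y \<in> S" for x y
    using norm_diff_commute[OF that] by simp
qed

text \<open>
  The reflection \<open>\<psi>\<close> at the midpoint \<open>z\<close> exchanges \<open>a\<close> and \<open>b\<close>. It turns an isometry \<open>g\<close> fixing \<open>a\<close> and \<open>b\<close>
  into the isometry \<open>\<psi> \<circ> g\<^sup>-\<^sup>1 \<circ> \<psi> \<circ> g\<close>, which fixes \<open>a\<close> and \<open>b\<close> as well and moves \<open>z\<close> twice as far
  as \<open>g\<close> does. Since all isometries fixing \<open>a\<close> move \<open>z\<close> by at most \<open>2 * N (a - z)\<close>, none of those
  fixing both points moves \<open>z\<close>.
\<close>
lemma surj_isometry_fixes_midpoint:
  assumes a: "a \<in> S" and b: "b \<in> S" and g: "surj_isometry g" "g a = a" "g b = b"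
  shows "g ((1/2) *\<^sub>R (a + b)) = (1/2) *\<^sub>R (a + b)"
proof -
  define z where "z = (1/2) *\<^sub>R (a + b)"
  have z: "z \<in> S" using a b by (simp add: z_def)
  have "2 *\<^sub>R z = a + b" by (simp add: z_def)
  then have zz: "z + z = a + b" by (simp add: scaleR_2)
  define \<psi> where "\<psi> x = (a + b) - x" for x
  have \<psi>: "surj_isometry \<psi>" unfolding \<psi>_def using a b by (intro surj_isometry_reflection) auto
  have \<psi>z: "\<psi> z = z" and \<psi>a: "\<psi> a = b" and \<psi>b: "\<psi> b = a"
    using zz by (auto simp: \<psi>_def algebra_simps)
  have "N (g z - z) \<le> 2 * N (a - z) / 2 ^ n"
    if "surj_isometry g" "g a = a" "g b = b" for n g
    using that
  proof (induction n arbitrary: g)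
    case 0
    have "N (g z - a) = N (z - a)" using surj_isometry_dist[OF 0(1) z a] 0 by simp
    then show ?case
      using norm_diff_triangle[of "g z" a z] surj_isometry_in[OF 0(1) z] z a
      by (simp add: norm_diff_commute)
  next
    case (Suc n)
    note inS = surj_isometry_in[OF Suc.prems(1)] surj_isometry_in[OF \<psi>]
    define h where "h x = \<psi> (inv_into S g (\<psi> (g x)))" for x
    have inv: "surj_isometry (inv_into S g)" by (rule surj_isometry_inv[OF Suc.prems(1)])
    have inj: "inj_on g S" by (rule surj_isometry_inj[OF Suc.prems(1)])
    have h: "surj_isometry h"
      unfolding h_def
      by (rule surj_isometry_comp[OF \<psi> surj_isometry_comp[OF inv
              surj_isometry_comp[OF \<psi> Suc.prems(1)]]])
    have "inv_into S g a = a" "inv_into S g b = b"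
      using inv_into_f_f[OF inj a] inv_into_f_f[OF inj b] Suc.prems by simp_all
    then have "h a = a" "h b = b" using Suc.prems by (simp_all add: h_def \<psi>a \<psi>b)
    from Suc.IH[OF h this] have IH: "N (h z - z) \<le> 2 * N (a - z) / 2 ^ n" .
    have gz: "g z \<in> S" "\<psi> (g z) \<in> S" using inS z by auto
    have "h z - z = \<psi> (inv_into S g (\<psi> (g z))) - \<psi> z" by (simp add: h_def \<psi>z)
    then have "N (h z - z) = N (inv_into S g (\<psi> (g z)) - z)"
      using surj_isometry_dist[OF \<psi> surj_isometry_in[OF inv gz(2)] z] by simp
    also have "\<dots> = N (inv_into S g (\<psi> (g z)) - inv_into S g (g z))"
      using inv_into_f_f[OF inj z] by simp
    also have "\<dots> = N (\<psi> (g z) - g z)" by (rule surj_isometry_dist[OF inv gz(2,1)])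
    also have "\<psi> (g z) - g z = (-2) *\<^sub>R (g z - z)"
      by (simp add: \<psi>_def scaleR_2 flip: zz)
    also have "N \<dots> = 2 * N (g z - z)" using gz z by (subst norm_scale) auto
    finally show ?case using IH by (simp add: field_simps)
  qed
  from this[OF g] have le: "N (g z - z) \<le> 2 * N (a - z) / 2 ^ n" for n .
  have "(\<lambda>n. 2 * N (a - z) * inverse (2 ^ n)) \<longlonglongrightarrow> 2 * N (a - z) * 0"
    by (intro tendsto_intros LIMSEQ_inverse_realpow_zero) auto
  then have "N (g z - z) \<le> 0"
    by (intro LIMSEQ_le_const[where X = "\<lambda>n. 2 * N (a - z) * inverse (2 ^ n)"])
      (use le in \<open>auto simp: divide_inverse\<close>)
  then show ?thesis
    using norm_nonneg[of "g z - z"] norm_eq_0[of "g z - z"] surj_isometry_in[OF g(1) z] z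
    by (simp add: z_def)
qed

text \<open>
  Reflecting at the midpoint of \<open>f a\<close> and \<open>f b\<close>, pulling back by \<open>f\<close> and reflecting at the midpoint
  of \<open>a\<close> and \<open>b\<close> gives an isometry fixing \<open>a\<close> and \<open>b\<close>. It fixes the midpoint, which says that \<open>f\<close>
  maps one centre of reflection to the other.
\<close>
lemma surj_isometry_midpoint:
  assumes a: "a \<in> S" and b: "b \<in> S" and f: "surj_isometry f"
  shows "f ((1/2) *\<^sub>R (a + b)) = (1/2) *\<^sub>R (f a + f b)"
proof -
  define z where "z = (1/2) *\<^sub>R (a + b)"
  have z: "z \<in> S" using a b by (simp add: z_def)
  have fab: "f a + f b \<in> S" using surj_isometry_in[OF f] a b by auto
  have inj: "inj_on f S" by (rule surj_isometry_inj[OF f])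
  define h where "h x = (a + b) - inv_into S f ((f a + f b) - f x)" for x
  have "surj_isometry h"
    unfolding h_def
    by (rule surj_isometry_comp[OF surj_isometry_reflection surj_isometry_comp[OF
            surj_isometry_inv[OF f] surj_isometry_comp[OF surj_isometry_reflection[OF fab] f]]])
      (use a b in auto)
  moreover have "h a = a" "h b = b"
    using inv_into_f_f[OF inj a] inv_into_f_f[OF inj b] by (simp_all add: h_def)
  ultimately have "h z = z" unfolding z_def by (rule surj_isometry_fixes_midpoint[OF a b])
  then have "inv_into S f ((f a + f b) - f z) = (a + b) - z" by (simp add: h_def algebra_simps)
  also have "2 *\<^sub>R z = a + b" by (simp add: z_def)
  then have "(a + b) - z = z" by (simp add: scaleR_2 algebra_simps)
  finally have "f z = f (inv_into S f ((f a + f b) - f z))" by simp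
  also have "\<dots> = (f a + f b) - f z"
    using f fab surj_isometry_in[OF f z] by (intro f_inv_into_f) (auto simp: surj_isometry_def)
  finally have "2 *\<^sub>R f z = f a + f b" by (simp add: scaleR_2 algebra_simps)
  then have "(1/2) *\<^sub>R (2 *\<^sub>R f z) = (1/2) *\<^sub>R (f a + f b)" by (rule arg_cong)
  then show ?thesis by (simp add: z_def)
qed

lemma surj_isometry_linear:
  assumes f: "surj_isometry f" and f0: "f 0 = 0" and x: "x \<in> S"
  shows "y \<in> S \<Longrightarrow> f (x + y) = f x + f y" and "f (c *\<^sub>R x) = c *\<^sub>R f x"
proof -
  note inS = surj_isometry_in[OF f]
  have half: "f ((1/2) *\<^sub>R x) = (1/2) *\<^sub>R f x" if "x \<in> S" for x
    using surj_isometry_midpoint[OF that carrier_closed(1) f] f0 by simp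
  have add: "f (x + y) = f x + f y" if x: "x \<in> S" and y: "y \<in> S" for x y
  proof -
    have "(1/2) *\<^sub>R f (x + y) = (1/2) *\<^sub>R (f x + f y)"
      using half[of "x + y"] surj_isometry_midpoint[OF x y f] x y by simp
    then show ?thesis by simp
  qed
  show "f (x + y) = f x + f y" if "y \<in> S" for y using add x that .
  have neg: "f (- x) = - f x" if "x \<in> S" for x
    using add[OF that, of "- x"] that f0 by (simp add: eq_neg_iff_add_eq_0 add.commute)
  have nat: "f (real n *\<^sub>R x) = real n *\<^sub>R f x" if "x \<in> S" for n x
    by (induction n) (use that f0 in \<open>auto simp: scaleR_left_distrib add\<close>)
  have int: "f (of_int m *\<^sub>R x) = of_int m *\<^sub>R f x" if "x \<in> S" for m x
    by (cases m rule: int_cases2) (use that in \<open>auto simp: nat neg\<close>)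
  \<comment> \<open>Write \<open>n c\<close> as an integer plus a fractional part \<open>q\<close>: the homogeneity defect at \<open>n c\<close> is the
    one at \<open>q\<close>, which is at most twice the norm of \<open>x\<close>, and it is \<open>n\<close> times the defect at \<open>c\<close>.\<close>
  have bound: "real n * N (f (c *\<^sub>R x) - c *\<^sub>R f x) \<le> 2 * N x" for n
  proof -
    define q where "q = frac (real n * c)"
    have nc: "real n * c = of_int \<lfloor>real n * c\<rfloor> + q" by (simp add: q_def frac_def)
    have q: "0 \<le> q" "q \<le> 1" using frac_ge_0 frac_lt_1[of "real n * c"] by (auto simp: q_def)
    have "real n *\<^sub>R (f (c *\<^sub>R x) - c *\<^sub>R f x) = f ((real n * c) *\<^sub>R x) - (real n * c) *\<^sub>R f x"
      using nat[of "c *\<^sub>R x" n] x by (simp add: scaleR_right_diff_distrib)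
    also have "\<dots> = f (q *\<^sub>R x) - q *\<^sub>R f x"
      using x by (subst (1 2) nc) (simp add: scaleR_left_distrib add int)
    finally have "real n * N (f (c *\<^sub>R x) - c *\<^sub>R f x) = N (f (q *\<^sub>R x) - q *\<^sub>R f x)"
      using norm_scale[of "f (c *\<^sub>R x) - c *\<^sub>R f x" "real n"] x inS by simp
    also have "\<dots> \<le> N (f (q *\<^sub>R x)) + N (q *\<^sub>R f x)"
      using x inS by (intro norm_triangle_diff) auto
    also have "N (f (q *\<^sub>R x)) = q * N x"
      using surj_isometry_dist[OF f, of "q *\<^sub>R x" 0] x f0 q by (simp add: norm_scale)
    also have "N (q *\<^sub>R f x) = q * N x"
      using surj_isometry_dist[OF f, of x 0] x f0 q inS[OF x] by (simp add: norm_scale)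
    also have "q * N x + q * N x \<le> 2 * N x"
      using q mult_right_mono[OF q(2) norm_nonneg[OF x]] by simp
    finally show ?thesis .
  qed
  have in0: "f (c *\<^sub>R x) - c *\<^sub>R f x \<in> S" using x inS by auto
  have "N (f (c *\<^sub>R x) - c *\<^sub>R f x) = 0"
  proof (rule ccontr)
    assume "\<not> ?thesis"
    then have "0 < N (f (c *\<^sub>R x) - c *\<^sub>R f x)" using norm_nonneg[OF in0] by simp
    from reals_Archimedean3[OF this, rule_format, of "2 * N x"] bound show False
      by (meson not_le)
  qed
  then show "f (c *\<^sub>R x) = c *\<^sub>R f x" using norm_eq_0[OF in0] by simp
qed

end

section \<open>Compactness: isometries and rigid motions in finite dimensions\<close>

locale finite_dim_normed_carrier = normed_carrier +
  assumes finite_span: "\<exists>B. finite B \<and> span B = S"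
begin

lemma bounded_sequence_compact:
  fixes X :: "nat \<Rightarrow> 'a"
  assumes "\<And>n. X n \<in> S" "\<And>n. N (X n) \<le> C"
  obtains r :: "nat \<Rightarrow> nat" and l where "strict_mono r" "l \<in> S" "(\<lambda>n. N (X (r n) - l)) \<longlonglongrightarrow> 0"
proof -
  obtain B where B: "finite B" "span B = S" using finite_span by blast
  have "B \<subseteq> S" using span_superset[of B] B(2) by simp
  from bounded_sequence_convergent_subsequence[OF B(1) this, of X C] assms that
  show thesis unfolding B(2) by blast
qed

text \<open>
  An isometric self-map of a compact metric space is onto, applied to the balls about the origin
  after normalising \<open>f 0 = 0\<close>.
\<close>
lemma isometry_surj:
  assumes fS: "\<And>x. x \<in> S \<Longrightarrow> f x \<in> S"
    and iso: "\<And>x y. x \<in> S \<Longrightarrow> y \<in> S \<Longrightarrow> N (f x - f y) = N (x - y)"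
  shows "surj_isometry f"
proof -
  define g where "g x = f x - f 0" for x
  have gS: "g x \<in> S" if "x \<in> S" for x using fS that by (simp add: g_def)
  have g_dist: "N (g x - g y) = N (x - y)" if "x \<in> S" "y \<in> S" for x y
    using iso that by (simp add: g_def)
  have g_norm: "N (g x) = N x" if "x \<in> S" for x
    using g_dist[OF that carrier_closed(1)] by (simp add: g_def)
  have "y \<in> f ` S" if "y \<in> S" for y
  proof -
    define u where "u = y - f 0"
    have u: "u \<in> S" using that fS by (simp add: u_def)
    define X where "X n = (g ^^ n) u" for n
    have XS: "X n \<in> S" for n by (induction n) (use u gS in \<open>auto simp: X_def\<close>)
    have XN: "N (X n) = N u" for n
    proof (induction n)
      case (Suc n)
      then show ?case using g_norm[OF XS[of n]] by (simp add: X_def)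
    qed (simp add: X_def)
    have shift: "N (X (m + k) - X m) = N (X k - u)" for m k
    proof (induction m)
      case (Suc m)
      then show ?case using g_dist[OF XS[of "m + k"] XS[of m]] by (simp add: X_def)
    qed (simp add: X_def)
    obtain r l where r: "strict_mono r" and l: "l \<in> S" and lim: "(\<lambda>n. N (X (r n) - l)) \<longlonglongrightarrow> 0"
      using bounded_sequence_compact[of X "N u"] XS XN by (metis order_refl)
    \<comment> \<open>The orbit of \<open>u\<close> comes close to itself, so it returns close to \<open>u\<close>.\<close>
    have "\<exists>w\<in>S. N w \<le> N u \<and> N (g w - u) < inverse (real (Suc n))" for n
    proof -
      have "\<forall>\<^sub>F k in sequentially. N (X (r k) - l) < inverse (real (Suc n)) / 2"
        by (rule order_tendstoD[OF lim]) simp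
      then obtain k where k: "\<And>i. i \<ge> k \<Longrightarrow> N (X (r i) - l) < inverse (real (Suc n)) / 2"
        by (auto simp: eventually_sequentially)
      have "r k < r (Suc k)" using r by (simp add: strict_mono_def)
      then obtain d where d: "r (Suc k) = r k + Suc d" using less_imp_Suc_add by auto
      have "N (X (Suc d) - u) = N (X (r (Suc k)) - X (r k))" using shift[of "r k" "Suc d"] d by simp
      also have "\<dots> \<le> N (X (r (Suc k)) - l) + N (X (r k) - l)"
        using norm_diff_triangle[OF XS l XS] norm_diff_commute[OF l XS] by metis
      also have "\<dots> < inverse (real (Suc n))" using k[of k] k[of "Suc k"] by simp
      finally have "N (g (X d) - u) < inverse (real (Suc n))" by (simp add: X_def)
      with XS[of d] XN[of d] show ?thesis by (intro bexI[of _ "X d"]) auto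
    qed
    then obtain w where w: "\<And>n. w n \<in> S" "\<And>n. N (w n) \<le> N u"
      "\<And>n. N (g (w n) - u) < inverse (real (Suc n))" by metis
    obtain r l where r: "strict_mono r" and l: "l \<in> S" and lim: "(\<lambda>n. N (w (r n) - l)) \<longlonglongrightarrow> 0"
      using bounded_sequence_compact[of w "N u"] w by metis
    have "(\<lambda>n. inverse (real (Suc (r n)))) \<longlonglongrightarrow> 0"
      using LIMSEQ_subseq_LIMSEQ[OF LIMSEQ_inverse_real_of_nat r] by (simp add: o_def)
    from tendsto_add[OF this lim]
    have "(\<lambda>n. inverse (real (Suc (r n))) + N (w (r n) - l)) \<longlonglongrightarrow> 0" by simp
    moreover have "N (u - g l) \<le> inverse (real (Suc (r n))) + N (w (r n) - l)" for n
      using norm_diff_triangle[OF u gS[OF w(1)] gS[OF l], of "r n"] w(3)[of "r n"]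
        g_dist[OF w(1) l, of "r n"] norm_diff_commute[OF u gS[OF w(1)], of "r n"] by simp
    ultimately have "N (u - g l) \<le> 0" by (intro LIMSEQ_le_const) auto
    then have "u = g l"
      using norm_nonneg[of "u - g l"] norm_eq_0[of "u - g l"] u gS[OF l] by simp
    then have "y = f l" by (simp add: u_def g_def)
    with l show ?thesis by blast
  qed
  then show ?thesis unfolding surj_isometry_def using fS iso by auto
qed

lemma rigid_motion_isometry:
  assumes "rigid_motion S N \<alpha> \<eta>" "t \<in> {-1..1}"
  shows "surj_isometry (\<lambda>x. \<alpha> x t - \<alpha> 0 t)"
  using assms by (intro isometry_surj) (auto simp: rigid_motion_def)

text \<open>
  The estimate is uniform in \<open>x\<close> and \<open>y\<close>, although \<open>\<alpha>\<close> is only assumed to be continuous in \<open>t\<close> for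
  each point separately. Isometries being affine, it is enough to control unit vectors, and those
  form a compact set on which the equicontinuous linear parts converge uniformly.
\<close>
lemma rigid_motion_near_identity:
  assumes \<alpha>: "rigid_motion S N \<alpha> \<eta>"
  obtains \<epsilon> where "0 < \<epsilon>" "\<epsilon> \<le> 1"
    "\<And>t x y. \<bar>t\<bar> \<le> \<epsilon> \<Longrightarrow> x \<in> S \<Longrightarrow> y \<in> S \<Longrightarrow>
       N ((\<alpha> x t - \<alpha> y t) - (x - y)) \<le> N (x - y) / 2"
proof (rule ccontr)
  assume no: "\<not> thesis"
  define \<phi> where "\<phi> t x = \<alpha> x t - \<alpha> 0 t" for t x
  have surj: "surj_isometry (\<phi> t)" if "t \<in> {-1..1}" for t
    using rigid_motion_isometry[OF \<alpha> that] by (simp add: \<phi>_def[abs_def])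
  have \<phi>0: "\<phi> t 0 = 0" for t by (simp add: \<phi>_def)
  have "\<exists>t x y. \<bar>t\<bar> \<le> inverse (real (Suc n)) \<and> x \<in> S \<and> y \<in> S \<and>
      N (x - y) / 2 < N ((\<alpha> x t - \<alpha> y t) - (x - y))" for n
  proof (rule ccontr)
    assume "\<not> ?thesis"
    then show False
      using no that[of "inverse (real (Suc n))"] by (force simp: not_less field_simps)
  qed
  then obtain t x y where t: "\<And>n. \<bar>t n\<bar> \<le> inverse (real (Suc n))"
    and x: "\<And>n. x n \<in> S" and y: "\<And>n. y n \<in> S"
    and far: "\<And>n. N (x n - y n) / 2 < N ((\<alpha> (x n) (t n) - \<alpha> (y n) (t n)) - (x n - y n))"
    by metis
  have tI: "t n \<in> {-1..1}" for n
  proof -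
    have "inverse (real (Suc n)) \<le> 1" by (simp add: field_simps)
    then show ?thesis using t[of n] by auto
  qed
  \<comment> \<open>By linearity the failure of the estimate can be moved to unit vectors \<open>v n\<close>.\<close>
  define u where "u n = x n - y n" for n
  have u: "u n \<in> S" for n using x y by (simp add: u_def)
  have \<phi>u: "\<phi> (t n) (u n) = \<alpha> (x n) (t n) - \<alpha> (y n) (t n)" for n
  proof -
    have "\<phi> (t n) (u n + y n) = \<phi> (t n) (u n) + \<phi> (t n) (y n)"
      by (rule surj_isometry_linear(1)[OF surj[OF tI] \<phi>0 u y])
    then show ?thesis by (simp add: u_def \<phi>_def)
  qed
  have upos: "0 < N (u n)" for n
  proof (rule ccontr)
    assume "\<not> ?thesis"
    then have "u n = 0" using norm_nonneg[OF u[of n]] norm_eq_0[OF u[of n]] by linarith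
    with far[of n] show False unfolding \<phi>u[symmetric] by (simp add: \<phi>0 u_def)
  qed
  define v where "v n = (1 / N (u n)) *\<^sub>R u n" for n
  have v: "v n \<in> S" for n using u by (simp add: v_def)
  have v1: "N (v n) = 1" for n using norm_scale[OF u] upos[of n] by (simp add: v_def)
  have \<phi>v: "1 / 2 < N (\<phi> (t n) (v n) - v n)" for n
  proof -
    have eq: "\<phi> (t n) (v n) - v n = (1 / N (u n)) *\<^sub>R (\<phi> (t n) (u n) - u n)"
      using surj_isometry_linear(2)[OF surj[OF tI] \<phi>0 u]
      by (simp add: v_def scaleR_right_diff_distrib)
    have "(1 / N (u n)) * (N (u n) / 2) < (1 / N (u n)) * N (\<phi> (t n) (u n) - u n)"
      using far[of n] upos[of n] unfolding \<phi>u u_def[symmetric]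
      by (intro mult_strict_left_mono) auto
    moreover have "N (\<phi> (t n) (v n) - v n) = (1 / N (u n)) * N (\<phi> (t n) (u n) - u n)"
      unfolding eq using u surj_isometry_in[OF surj[OF tI] u] upos[of n]
      by (subst norm_scale) auto
    ultimately show ?thesis using upos[of n] by simp
  qed
  obtain r l where r: "strict_mono r" and l: "l \<in> S" and lim: "(\<lambda>n. N (v (r n) - l)) \<longlonglongrightarrow> 0"
    using bounded_sequence_compact[of v 1] v v1 by (metis order_refl)
  have t0: "(\<lambda>n. t (r n)) \<longlonglongrightarrow> 0"
  proof -
    have "t \<longlonglongrightarrow> 0"
      by (rule Lim_null_comparison[OF _ LIMSEQ_inverse_real_of_nat]) (use t in auto)
    then show ?thesis using LIMSEQ_subseq_LIMSEQ[OF _ r] by (fastforce simp: o_def)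
  qed
  have path: "(\<lambda>n. N (\<alpha> w (t (r n)) - w)) \<longlonglongrightarrow> 0" if "w \<in> S" for w
  proof -
    have 0: "\<alpha> w 0 = w" using \<alpha> that by (simp add: rigid_motion_def)
    have "((\<lambda>s. N (\<alpha> w s - w)) \<longlongrightarrow> N (\<alpha> w 0 - w)) (at 0 within {-1..1})"
    proof -
      have "\<forall>x\<in>S. \<forall>t\<in>{-1..1}. norm_tendsto N (\<alpha> x) (\<alpha> x t) (at t within {-1..1})"
        using \<alpha> by (simp add: rigid_motion_def)
      then have "norm_tendsto N (\<alpha> w) (\<alpha> w 0) (at 0 within {-1..1})" using that by simp
      then show ?thesis by (simp add: norm_tendsto_def 0)
    qed
    then have "continuous (at 0 within {-1..1}) (\<lambda>s. N (\<alpha> w s - w))"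
      by (simp add: continuous_within)
    then have "((\<lambda>s. N (\<alpha> w s - w)) \<circ> (\<lambda>n. t (r n))) \<longlonglongrightarrow> N (\<alpha> w 0 - w)"
      using t0 tI by (auto simp: continuous_within_sequentially)
    then show ?thesis by (simp add: 0 o_def)
  qed
  have "(\<lambda>n. 2 * N (v (r n) - l) + (N (\<alpha> l (t (r n)) - l) + N (\<alpha> 0 (t (r n)) - 0)))
      \<longlonglongrightarrow> 2 * 0 + (0 + 0)"
    by (intro tendsto_intros lim path l carrier_closed(1))
  moreover have "1 / 2 \<le> 2 * N (v (r n) - l) + (N (\<alpha> l (t (r n)) - l) + N (\<alpha> 0 (t (r n)) - 0))"
    for n
  proof -
    let ?f = "\<phi> (t (r n))" and ?v = "v (r n)"
    note vS = v[of "r n"] and fv = surj_isometry_in[OF surj[OF tI] v, of "r n"]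
      and fl = surj_isometry_in[OF surj[OF tI] l, of "r n"]
    have \<alpha>S: "\<alpha> l (t (r n)) \<in> S" "\<alpha> 0 (t (r n)) \<in> S"
      using \<alpha> tI[of "r n"] l by (auto simp: rigid_motion_def)
    have "N (?f ?v - ?v) \<le> N (?f ?v - ?f l) + N (?f l - ?v)"
      by (rule norm_diff_triangle) (use vS fv fl in auto)
    moreover have "N (?f l - ?v) \<le> N (?f l - l) + N (l - ?v)"
      by (rule norm_diff_triangle) (use vS fl l in auto)
    moreover have "N (?f ?v - ?f l) = N (?v - l)"
      by (rule surj_isometry_dist[OF surj[OF tI] vS l])
    moreover have "N (l - ?v) = N (?v - l)" by (rule norm_diff_commute[OF l vS])
    moreover have "N (?f l - l) \<le> N (\<alpha> l (t (r n)) - l) + N (\<alpha> 0 (t (r n)) - 0)"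
      using norm_triangle_diff[of "\<alpha> l (t (r n)) - l" "\<alpha> 0 (t (r n))"] \<alpha>S l
      by (simp add: \<phi>_def algebra_simps)
    ultimately show ?thesis using \<phi>v[of "r n"] by linarith
  qed
  ultimately have "(1 / 2 :: real) \<le> 2 * 0 + (0 + 0)" by (intro LIMSEQ_le_const) auto
  then show False by simp
qed

end

section \<open>Support functionals in finite dimensions\<close>

context finite_dim_normed_carrier
begin

text \<open>
  Hahn-Banach in finite dimensions. The functional is kept linear on the whole ambient space; the
  bound is extended one spanning vector at a time.
\<close>
lemma support_functional_on_span:
  assumes "finite B" "B \<subseteq> S" "u \<in> S" "u \<noteq> 0"
  shows "\<exists>f. linear f \<and> f u = N u \<and> (\<forall>x\<in>span (insert u B). f x \<le> N x)"
  using assms(1,2)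
proof (induction B rule: finite_induct)
  case empty
  have "independent {u}" using assms(4) by simp
  from linear_independent_extend[OF this, of "\<lambda>_. N u"]
  obtain f where f: "linear f" "f u = N u" by auto
  have "f x \<le> N x" if "x \<in> span {u}" for x
  proof -
    obtain k where "x = k *\<^sub>R u" using \<open>x \<in> span {u}\<close> by (auto simp: span_singleton)
    then show ?thesis
      using f norm_scale[OF assms(3)] norm_nonneg[OF assms(3)]
      by (simp add: linear_cmul mult_right_mono)
  qed
  with f show ?case by auto
next
  case (insert b B)
  let ?M = "span (insert u B)"
  obtain f where f: "linear f" "f u = N u" "\<And>x. x \<in> ?M \<Longrightarrow> f x \<le> N x"
    using insert by auto
  have b: "b \<in> S" using insert.prems by simp
  have M: "x \<in> S" if "x \<in> ?M" for x
    using span_subset_carrier[of "insert u B"] insert.prems assms(3) that by auto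
  show ?case
  proof (cases "b \<in> ?M")
    case True
    then have "span (insert b (insert u B)) = ?M" by (rule span_redundant)
    then show ?thesis using f by (auto simp: insert_commute)
  next
    case False
    obtain C where C: "C \<subseteq> insert u B" "independent C" "span C = ?M"
      using maximal_independent_subset[of "insert u B"]
      by (metis span_mono span_span subset_antisym)
    have "independent (insert b C)" using C False by (simp add: independent_insert)
    from linear_independent_extend[OF this, of "\<lambda>x. if x = b then 1 else 0"]
    obtain h :: "'a \<Rightarrow> real" where h: "linear h" "h b = 1" "\<And>x. x \<in> C \<Longrightarrow> h x = 0"
      using C(3) False span_base[of _ C] by (metis insert_iff)
    have h0: "h x = 0" if "x \<in> ?M" for x
      using linear_eq_0_on_span[OF h(1,3)] that C(3) by auto
    \<comment> \<open>The interval of admissible values at \<open>b\<close> is nonempty; \<open>s\<close> is its left end.\<close>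
    have gap: "f y - N (y - b) \<le> N (y' + b) - f y'" if "y \<in> ?M" "y' \<in> ?M" for y y'
    proof -
      have "f y + f y' = f (y + y')" using f(1) by (simp add: linear_add)
      also have "\<dots> \<le> N ((y - b) + (y' + b))" using f(3)[OF span_add[OF that]] by simp
      also have "\<dots> \<le> N (y - b) + N (y' + b)"
        using M[OF that(1)] M[OF that(2)] b by (intro norm_triangle) auto
      finally show ?thesis by simp
    qed
    define s where "s = (SUP y\<in>?M. f y - N (y - b))"
    have bdd: "bdd_above ((\<lambda>y. f y - N (y - b)) ` ?M)"
      by (rule bdd_aboveI2[OF gap[OF _ span_zero]])
    have lo: "f y - N (y - b) \<le> s" if "y \<in> ?M" for y
      unfolding s_def by (rule cSUP_upper[OF that bdd])
    have hi: "s \<le> N (y + b) - f y" if "y \<in> ?M" for y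
      unfolding s_def using gap[OF _ that] span_zero by (intro cSUP_least) auto
    \<comment> \<open>\<open>h\<close> vanishes on \<open>span (insert u B)\<close> and is 1 at \<open>b\<close>, so this corrects the value at \<open>b\<close> only.\<close>
    define g where "g x = f x + (s - f b) * h x" for x
    have g: "linear g"
      unfolding g_def using f(1) h(1)
      by (intro linearI) (simp_all add: linear_add linear_cmul algebra_simps)
    have gM: "g x = f x" if "x \<in> ?M" for x using h0[OF that] by (simp add: g_def)
    have gb: "g b = s" by (simp add: g_def h)
    have "g x \<le> N x" if x: "x \<in> span (insert b (insert u B))" for x
    proof -
      obtain k where k: "x - k *\<^sub>R b \<in> ?M" using x by (auto simp: span_breakdown_eq)
      define y where "y = x - k *\<^sub>R b"
      have y: "y \<in> ?M" and xy: "x = y + k *\<^sub>R b" using k by (simp_all add: y_def)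
      have gx: "g x = f y + k * s"
        using gM[OF y] gb g by (simp add: xy linear_add linear_cmul)
      consider "k = 0" | "k > 0" | "k < 0" by linarith
      then show ?thesis
      proof cases
        case 1
        then show ?thesis using gx f(3)[OF y] xy by simp
      next
        case 2
        have z: "(1 / k) *\<^sub>R y \<in> ?M" using y by (rule span_scale)
        have "N x = k * N ((1 / k) *\<^sub>R y + b)"
          using norm_scale[of "(1 / k) *\<^sub>R y + b" k] M[OF z] b 2
          by (simp add: xy scaleR_right_distrib)
        moreover have "k * s \<le> k * (N ((1 / k) *\<^sub>R y + b) - f ((1 / k) *\<^sub>R y))"
          using hi[OF z] 2 by simp
        ultimately show ?thesis using gx 2 f(1) by (simp add: linear_cmul right_diff_distrib)
      next
        case 3
        have z: "(- 1 / k) *\<^sub>R y \<in> ?M" using y by (rule span_scale)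
        have "k *\<^sub>R b + y = (- k) *\<^sub>R ((- 1 / k) *\<^sub>R y - b)"
          using 3 by (simp add: scaleR_right_diff_distrib)
        then have "N x = (- k) * N ((- 1 / k) *\<^sub>R y - b)"
          using norm_scale[of "(- 1 / k) *\<^sub>R y - b" "- k"] M[OF z] b 3
          by (simp add: xy add.commute)
        moreover have "(- k) * (f ((- 1 / k) *\<^sub>R y) - N ((- 1 / k) *\<^sub>R y - b)) \<le> (- k) * s"
          using lo[OF z] 3 by (intro mult_left_mono) auto
        moreover have "(- k) * f ((- 1 / k) *\<^sub>R y) = f y"
          using 3 linear_cmul[OF f(1), of "- 1 / k" y] by simp
        ultimately show ?thesis using gx by (simp add: right_diff_distrib)
      qed
    qed
    moreover have "g u = N u" using gM[of u] f(2) span_base[of u "insert u B"] by simp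
    ultimately show ?thesis using g by (auto simp: insert_commute)
  qed
qed

lemma support_functional_exists:
  assumes u: "u \<in> S" "u \<noteq> 0"
  obtains f where "linear f" "f u = N u" "\<And>x. x \<in> S \<Longrightarrow> \<bar>f x\<bar> \<le> N x"
proof -
  obtain B where B: "finite B" "span B = S" using finite_span by blast
  have "B \<subseteq> S" using span_superset[of B] B(2) by simp
  from support_functional_on_span[OF B(1) this u] obtain f
    where f: "linear f" "f u = N u" "\<forall>x\<in>span (insert u B). f x \<le> N x" by blast
  have "span (insert u B) = S" using B(2) u(1) by (simp add: span_redundant)
  then have le: "f x \<le> N x" if "x \<in> S" for x using f(3) that by simp
  have "\<bar>f x\<bar> \<le> N x" if "x \<in> S" for x
    using le[OF that] le[of "- x"] that f(1) by (auto simp: linear_neg norm_minus)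
  with f that show thesis by blast
qed

end

section \<open>Products of normed spaces\<close>

lemma vec_eq_sum_axis: "x = (\<Sum>j\<in>UNIV. axis j (x $ j :: 'a::real_vector))"
  by (simp add: vec_eq_iff axis_def if_distrib cong: if_cong)

lemma norm_tendsto_prod:
  fixes N :: "'n::finite \<Rightarrow> 'a::real_vector \<Rightarrow> real"
  assumes "\<And>j. norm_tendsto (N j) (\<lambda>t. f t $ j) (l $ j) F"
  shows "norm_tendsto (prod_norm N) f l F"
  unfolding norm_tendsto_def
proof (rule Lim_null_comparison)
  have "((\<lambda>t. \<Sum>j\<in>UNIV. \<bar>N j (f t $ j - l $ j)\<bar>) \<longlongrightarrow> (\<Sum>j\<in>(UNIV :: 'n set). \<bar>0\<bar>)) F"
    by (intro tendsto_sum tendsto_rabs) (use assms in \<open>simp add: norm_tendsto_def\<close>)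
  then show "((\<lambda>t. \<Sum>j\<in>UNIV. \<bar>N j (f t $ j - l $ j)\<bar>) \<longlongrightarrow> 0) F" by simp
  have "norm (prod_norm N (f t - l)) \<le> (\<Sum>j\<in>UNIV. \<bar>N j (f t $ j - l $ j)\<bar>)" for t
  proof -
    obtain k where "prod_norm N (f t - l) = N k ((f t - l) $ k)" using prod_norm_attained by blast
    moreover have "\<bar>N k (f t $ k - l $ k)\<bar> \<le> (\<Sum>j\<in>UNIV. \<bar>N j (f t $ j - l $ j)\<bar>)"
      by (rule member_le_sum) auto
    ultimately show ?thesis by simp
  qed
  then show "\<forall>\<^sub>F t in F. norm (prod_norm N (f t - l)) \<le> (\<Sum>j\<in>UNIV. \<bar>N j (f t $ j - l $ j)\<bar>)"
    by simp
qed

locale normed_product =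
  fixes S :: "'n::finite \<Rightarrow> 'a::real_vector set" and N :: "'n \<Rightarrow> 'a \<Rightarrow> real"
  assumes factors: "\<And>j. finite_dim_normed_space_on (S j) (N j)"

sublocale normed_product \<subseteq> factor: finite_dim_normed_carrier "S j" "N j" for j
  using factors[of j] by unfold_locales (auto simp: finite_dim_normed_space_on_def)

context normed_product
begin

abbreviation P :: "('a ^ 'n) set" where "P \<equiv> prod_carrier S"

lemma in_prod_iff: "x \<in> P \<longleftrightarrow> (\<forall>j. x $ j \<in> S j)"
  by (simp add: prod_carrier_def)

lemma component_in [simp]: "x \<in> P \<Longrightarrow> x $ j \<in> S j"
  by (simp add: in_prod_iff)

lemma axis_in_prod [simp]: "axis j a \<in> P \<longleftrightarrow> a \<in> S j"
  by (auto simp: in_prod_iff axis_def)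

lemma prod_finite_span: "\<exists>B. finite B \<and> span B = P"
proof -
  obtain B where B: "\<And>j. finite (B j)" "\<And>j. span (B j) = S j"
    using factor.finite_span by metis
  define C where "C = (\<Union>j. axis j ` B j)"
  have subP: "subspace P"
    using normed_space_on_prod[of S N] factor.normed by (simp add: normed_space_on_def)
  have lin: "linear (axis j :: 'a \<Rightarrow> 'a ^ 'n)" for j
    by (rule linearI) (auto simp: vec_eq_iff axis_def)
  have "axis j a \<in> span C" if "a \<in> S j" for j a
  proof -
    have "axis j a \<in> axis j ` span (B j)" using that B by simp
    also have "\<dots> = span (axis j ` B j)" by (rule linear_span_image[OF lin, symmetric])
    also have "\<dots> \<subseteq> span C" by (rule span_mono) (auto simp: C_def)
    finally show ?thesis .
  qed
  then have "x \<in> span C" if "x \<in> P" for x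
    using that by (subst vec_eq_sum_axis) (auto intro!: span_sum)
  moreover have "C \<subseteq> P" using span_superset B(2) by (fastforce simp: C_def)
  then have "span C \<subseteq> P" by (rule span_minimal[OF _ subP])
  moreover have "finite C" using B by (simp add: C_def)
  ultimately show ?thesis by (intro exI[of _ C]) auto
qed

end

sublocale normed_product \<subseteq> prod: finite_dim_normed_carrier "prod_carrier S" "prod_norm N"
  using normed_space_on_prod[of S N] factor.normed prod_finite_span by unfold_locales auto

context normed_product
begin

lemma prod_norm_axis [simp]:
  assumes "a \<in> S j"
  shows "prod_norm N (axis j a) = N j a"
proof (rule antisym)
  obtain k where k: "prod_norm N (axis j a) = N k (axis j a $ k)" using prod_norm_attained by blast
  then show "prod_norm N (axis j a) \<le> N j a"
    using factor.norm_nonneg[OF assms] by (cases "k = j") (auto simp: axis_def)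
  show "N j a \<le> prod_norm N (axis j a)"
    using prod_norm_ge[of N j "axis j a"] by (simp add: axis_def)
qed

lemma prod_norm_strictly_dominant:
  assumes "\<And>k. k \<noteq> j \<Longrightarrow> N k (x $ k) < N j (x $ j)"
  shows "prod_norm N x = N j (x $ j)"
proof -
  obtain k where k: "prod_norm N x = N k (x $ k)" using prod_norm_attained by blast
  then have "k = j" using assms[of k] prod_norm_ge[of N j x] by fastforce
  with k show ?thesis by simp
qed

lemma norm_tendsto_component:
  assumes "norm_tendsto (prod_norm N) f l F" "\<forall>\<^sub>F t in F. f t \<in> P" "l \<in> P"
  shows "norm_tendsto (N j) (\<lambda>t. f t $ j) (l $ j) F"
  unfolding norm_tendsto_def
proof (rule Lim_null_comparison)
  show "((\<lambda>t. prod_norm N (f t - l)) \<longlongrightarrow> 0) F" using assms(1) by (simp add: norm_tendsto_def)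
  show "\<forall>\<^sub>F t in F. norm (N j (f t $ j - l $ j)) \<le> prod_norm N (f t - l)"
    using assms(2)
  proof eventually_elim
    case (elim t)
    then show ?case
      using prod_norm_ge[of N j "f t - l"] factor.norm_nonneg[of "(f t - l) $ j" j] assms(3) by simp
  qed
qed

end

section \<open>Isometries of a product near the identity preserve the factors\<close>

text \<open>
  Isometries far from the identity may permute isometric factors, so closeness to the identity is essential. It has
  to be measured relative to \<open>x - y\<close> for the conclusions to hold at all scales.
\<close>
locale near_identity_isometry = normed_product S N
  for S :: "'n::finite \<Rightarrow> 'a::real_vector set" and N :: "'n \<Rightarrow> 'a \<Rightarrow> real" +
  fixes \<phi> :: "'a ^ 'n \<Rightarrow> 'a ^ 'n"
  assumes maps: "x \<in> P \<Longrightarrow> \<phi> x \<in> P"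
    and dist: "x \<in> P \<Longrightarrow> y \<in> P \<Longrightarrow> prod_norm N (\<phi> x - \<phi> y) = prod_norm N (x - y)"
    and near: "x \<in> P \<Longrightarrow> y \<in> P \<Longrightarrow>
      prod_norm N ((\<phi> x - \<phi> y) - (x - y)) \<le> prod_norm N (x - y) / 2"
begin

text \<open>
  The other components of \<open>\<phi> x - \<phi> y\<close> stay shorter than \<open>x - y\<close>, so the \<open>j\<close>-th one has to attain
  the preserved norm.
\<close>
lemma dominant_component:
  assumes x: "x \<in> P" and y: "y \<in> P"
    and small: "\<And>k. k \<noteq> j \<Longrightarrow> N k (x $ k - y $ k) < prod_norm N (x - y) / 2"
  shows "N j (\<phi> x $ j - \<phi> y $ j) = prod_norm N (x - y)"
proof -
  obtain k where k: "prod_norm N (\<phi> x - \<phi> y) = N k ((\<phi> x - \<phi> y) $ k)"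
    using prod_norm_attained by blast
  have "k = j"
  proof (rule ccontr)
    assume "k \<noteq> j"
    let ?e = "(\<phi> x - \<phi> y) - (x - y)"
    have "N k ((\<phi> x - \<phi> y) $ k) = N k (?e $ k + (x - y) $ k)" by simp
    also have "\<dots> \<le> N k (?e $ k) + N k ((x - y) $ k)"
      using x y maps by (intro factor.norm_triangle) auto
    also have "\<dots> < prod_norm N (x - y)"
      using prod_norm_ge[of N k ?e] near[OF x y] small[OF \<open>k \<noteq> j\<close>] by simp
    finally show False using k dist[OF x y] by simp
  qed
  with k dist[OF x y] show ?thesis by simp
qed

definition replace :: "'n \<Rightarrow> 'a ^ 'n \<Rightarrow> 'a \<Rightarrow> 'a ^ 'n" where
  "replace j x s = (\<chi> k. if k = j then s else x $ k)"

lemma replace_in: "x \<in> P \<Longrightarrow> s \<in> S j \<Longrightarrow> replace j x s \<in> P"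
  by (auto simp: in_prod_iff replace_def)

lemma replace_isometry:
  assumes x: "x \<in> P" and s: "s \<in> S j" "s' \<in> S j"
  shows "N j (\<phi> (replace j x s) $ j - \<phi> (replace j x s') $ j) = N j (s - s')"
proof (cases "s = s'")
  case False
  have eq: "replace j x s - replace j x s' = axis j (s - s')"
    by (auto simp: vec_eq_iff replace_def axis_def)
  have pos: "0 < N j (s - s')"
    using False factor.norm_nonneg[of "s - s'" j] factor.norm_eq_0[of "s - s'" j] s by fastforce
  have "N j (\<phi> (replace j x s) $ j - \<phi> (replace j x s') $ j)
      = prod_norm N (replace j x s - replace j x s')"
  proof (rule dominant_component)
    fix k assume "k \<noteq> j"
    then show "N k (replace j x s $ k - replace j x s' $ k)
        < prod_norm N (replace j x s - replace j x s') / 2"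
      using pos s unfolding eq by (simp add: replace_def)
  qed (use x s replace_in in auto)
  then show ?thesis using s unfolding eq by simp
qed simp

text \<open>
  If \<open>d = \<phi> x $ j - \<phi> y $ j\<close> were nonzero, choose \<open>w\<close> differing from \<open>x\<close> only in the \<open>j\<close>-th component,
  such that \<open>\<phi> w $ j\<close> lies far away from \<open>\<phi> x $ j\<close> in the direction of \<open>d\<close>. Then \<open>w - x\<close> and \<open>w - y\<close>
  have the same norm and both are dominated by the \<open>j\<close>-th component, so \<open>\<phi> w $ j\<close> has the same
  distance from \<open>\<phi> x $ j\<close> and \<open>\<phi> y $ j\<close>. But these are different points on one ray from \<open>\<phi> w $ j\<close>.
\<close>
lemma component_dependence:
  assumes x: "x \<in> P" and y: "y \<in> P" and xy: "x $ j = y $ j"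
  shows "\<phi> x $ j = \<phi> y $ j"
proof (rule ccontr)
  assume ne: "\<phi> x $ j \<noteq> \<phi> y $ j"
  define d where "d = \<phi> x $ j - \<phi> y $ j"
  have d: "d \<in> S j" using maps x y by (simp add: d_def)
  have dpos: "0 < N j d"
    using factor.norm_nonneg[OF d] factor.norm_eq_0[OF d] ne by (fastforce simp: d_def)
  define R where "R = prod_norm N (x - y)"
  have R: "0 \<le> R" using prod.norm_nonneg[of "x - y"] x y by (simp add: R_def)
  \<comment> \<open>At distance \<open>\<rho> * N j d\<close>, more than \<open>2 * R\<close>, the \<open>j\<close>-th component dominates \<open>w - y\<close>.\<close>
  define \<rho> where "\<rho> = 2 * R / N j d + 1"
  have \<rho>: "0 < \<rho>" using R dpos by (simp add: \<rho>_def add_nonneg_pos)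
  have \<rho>R: "2 * R < \<rho> * N j d" using dpos by (simp add: \<rho>_def field_simps)
  have "factor.surj_isometry j (\<lambda>s. \<phi> (replace j x s) $ j)"
    using x maps replace_in replace_isometry by (intro factor.isometry_surj) auto
  moreover have "\<phi> x $ j + \<rho> *\<^sub>R d \<in> S j" using maps x d by simp
  ultimately have "\<phi> x $ j + \<rho> *\<^sub>R d \<in> (\<lambda>s. \<phi> (replace j x s) $ j) ` S j"
    unfolding factor.surj_isometry_def by simp
  then obtain s where s: "s \<in> S j" "\<phi> (replace j x s) $ j = \<phi> x $ j + \<rho> *\<^sub>R d"
    by force
  define w where "w = replace j x s"
  have w: "w \<in> P" using x s by (simp add: w_def replace_in)
  have wj: "w $ j = s" and wk: "\<And>k. k \<noteq> j \<Longrightarrow> w $ k = x $ k" by (auto simp: w_def replace_def)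
  have "replace j x (x $ j) = x" by (simp add: vec_eq_iff replace_def)
  then have "N j (s - x $ j) = N j (\<rho> *\<^sub>R d)"
    using replace_isometry[OF x s(1), of "x $ j"] x s(2) by simp
  then have Ns: "N j ((w - y) $ j) = \<rho> * N j d"
    using factor.norm_scale[OF d] \<rho> xy by (simp add: wj)
  have small: "N k ((w - y) $ k) < \<rho> * N j d / 2" if "k \<noteq> j" for k
    using prod_norm_ge[of N k "x - y"] \<rho>R wk[OF that] by (simp add: R_def)
  have pn: "prod_norm N (w - y) = \<rho> * N j d"
    unfolding Ns[symmetric]
  proof (rule prod_norm_strictly_dominant)
    fix k assume "k \<noteq> j"
    from small[OF this] mult_pos_pos[OF \<rho> dpos] show "N k ((w - y) $ k) < N j ((w - y) $ j)"
      unfolding Ns by linarith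
  qed
  have "N j (\<phi> w $ j - \<phi> y $ j) = \<rho> * N j d"
    using dominant_component[OF w y, of j] small unfolding pn by simp
  moreover have "\<phi> w $ j - \<phi> y $ j = (\<rho> + 1) *\<^sub>R d"
    using s(2) by (simp add: w_def d_def scaleR_left_distrib)
  ultimately have "(\<rho> + 1) * N j d = \<rho> * N j d"
    using factor.norm_scale[OF d, of "\<rho> + 1"] \<rho> by simp
  then show False using dpos by (simp add: distrib_right)
qed

lemma component_isometry:
  assumes "a \<in> S j" "b \<in> S j"
  shows "N j (\<phi> (axis j a) $ j - \<phi> (axis j b) $ j) = N j (a - b)"
proof -
  have "replace j 0 c = axis j c" for c by (simp add: vec_eq_iff replace_def axis_def)
  with replace_isometry[of 0 a j b] assms show ?thesis by simp
qed

end

section \<open>Infinitesimal rigid motions of a product\<close>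

context normed_product
begin

text \<open>
  Restrict the motion to the \<open>j\<close>-th coordinate axis and project back to the factor \<open>j\<close>. This is a
  rigid motion for \<open>\<bar>t\<bar> \<le> \<epsilon>\<close>; beyond, the motion is stopped, which leaves the derivative at \<open>0\<close>
  unchanged.
\<close>
lemma infinitesimal_rigid_motion_components:
  assumes "\<eta> \<in> infinitesimal_rigid_motions P (prod_norm N)"
  obtains \<eta>\<^sub>j where "\<eta>\<^sub>j \<in> infinitesimal_rigid_motions (S j) (N j)"
    "\<And>x. x \<in> P \<Longrightarrow> \<eta> x $ j = \<eta>\<^sub>j (x $ j)"
proof -
  obtain \<alpha> where \<alpha>: "rigid_motion P (prod_norm N) \<alpha> \<eta>"
    using assms by (auto simp: infinitesimal_rigid_motions_def)
  obtain \<epsilon> where \<epsilon>: "0 < \<epsilon>" "\<epsilon> \<le> 1"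
    and near: "\<And>t x y. \<bar>t\<bar> \<le> \<epsilon> \<Longrightarrow> x \<in> P \<Longrightarrow> y \<in> P \<Longrightarrow>
       prod_norm N ((\<alpha> x t - \<alpha> y t) - (x - y)) \<le> prod_norm N (x - y) / 2"
    using prod.rigid_motion_near_identity[OF \<alpha>] by metis
  have \<alpha>P: "\<alpha> x t \<in> P" if "x \<in> P" "t \<in> {-1..1}" for x t
    using \<alpha> that by (simp add: rigid_motion_def)
  have \<alpha>0: "\<alpha> x 0 = x" if "x \<in> P" for x using \<alpha> that by (simp add: rigid_motion_def)
  have \<eta>P: "\<eta> x \<in> P" if "x \<in> P" for x using \<alpha> that by (simp add: rigid_motion_def)
  have near_iso: "near_identity_isometry S N (\<lambda>x. \<alpha> x t)" if "\<bar>t\<bar> \<le> \<epsilon>" for t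
  proof unfold_locales
    have t: "t \<in> {-1..1}" using that \<epsilon> by auto
    show "\<alpha> x t \<in> P" if "x \<in> P" for x using \<alpha>P that t .
    show "prod_norm N (\<alpha> x t - \<alpha> y t) = prod_norm N (x - y)" if "x \<in> P" "y \<in> P" for x y
      using \<alpha> that t unfolding rigid_motion_def by blast
  qed (use near that in auto)
  have der: "norm_tendsto (N j) (\<lambda>t. (1 / t) *\<^sub>R (\<alpha> x t $ j - x $ j)) (\<eta> x $ j) (at 0)"
    if x: "x \<in> P" for x
  proof -
    have "norm_tendsto (prod_norm N) (\<lambda>t. (1 / t) *\<^sub>R (\<alpha> x t - x)) (\<eta> x) (at 0)"
      using \<alpha> x \<alpha>0[OF x] by (auto simp: rigid_motion_def)
    moreover have "\<forall>\<^sub>F t in at (0::real). (1 / t) *\<^sub>R (\<alpha> x t - x) \<in> P"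
      unfolding eventually_at
    proof (intro exI[of _ 1] conjI ballI impI)
      fix t :: real assume "t \<noteq> 0 \<and> dist t 0 < 1"
      then have "\<alpha> x t \<in> P" by (intro \<alpha>P[OF x]) (auto simp: dist_real_def)
      with x show "(1 / t) *\<^sub>R (\<alpha> x t - x) \<in> P" by simp
    qed simp
    ultimately show ?thesis using norm_tendsto_component[OF _ _ \<eta>P[OF x], of _ _ j] by fastforce
  qed
  have small: "\<forall>\<^sub>F t in at (0::real). \<bar>t\<bar> \<le> \<epsilon>"
    unfolding eventually_at using \<epsilon> by (intro exI[of _ \<epsilon>]) auto
  define c where "c t = max (- \<epsilon>) (min \<epsilon> t)" for t
  have c: "\<bar>c t\<bar> \<le> \<epsilon>" "c t \<in> {-1..1}" for t using \<epsilon> by (auto simp: c_def)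
  have c_id: "c t = t" if "\<bar>t\<bar> \<le> \<epsilon>" for t using that by (auto simp: c_def)
  define \<beta> where "\<beta> a t = \<alpha> (axis j a) (c t) $ j" for a t
  define \<eta>\<^sub>j where "\<eta>\<^sub>j a = \<eta> (axis j a) $ j" for a
  have "rigid_motion (S j) (N j) \<beta> \<eta>\<^sub>j"
    unfolding rigid_motion_def
  proof (intro conjI ballI)
    fix a assume a: "a \<in> S j"
    then have ax: "axis j a \<in> P" by simp
    show "\<beta> a t \<in> S j" for t using \<alpha>P[OF ax c(2)] by (simp add: \<beta>_def)
    show \<beta>0: "\<beta> a 0 = a" using \<alpha>0[OF ax] c_id[of 0] \<epsilon> by (simp add: \<beta>_def)
    show "\<eta>\<^sub>j a \<in> S j" using \<eta>P[OF ax] by (simp add: \<eta>\<^sub>j_def)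
    show "norm_tendsto (N j) (\<beta> a) (\<beta> a t) (at t within {-1..1})" if "t \<in> {-1..1}" for t
    proof -
      let ?h = "\<lambda>s. prod_norm N (\<alpha> (axis j a) s - \<alpha> (axis j a) (c t))"
      have "continuous (at (c t) within {-1..1}) ?h"
        using \<alpha> ax c(2)[of t]
        by (simp add: continuous_within rigid_motion_def norm_tendsto_def)
      then have "continuous (at (c t) within c ` {-1..1}) ?h"
        by (rule continuous_within_subset) (use c in auto)
      moreover have "continuous (at t within {-1..1}) c"
        unfolding c_def by (intro continuous_intros)
      ultimately have "continuous (at t within {-1..1}) (\<lambda>s. ?h (c s))"
        by (intro continuous_within_compose2[of t "{-1..1}" c ?h])
      then have "norm_tendsto (prod_norm N) (\<lambda>s. \<alpha> (axis j a) (c s)) (\<alpha> (axis j a) (c t))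
          (at t within {-1..1})"
        by (simp add: continuous_within norm_tendsto_def)
      then show ?thesis
        unfolding \<beta>_def using \<alpha>P[OF ax c(2)]
        by (intro norm_tendsto_component) auto
    qed
    show "norm_tendsto (N j) (\<lambda>t. (1 / t) *\<^sub>R (\<beta> a t - \<beta> a 0)) (\<eta>\<^sub>j a) (at 0)"
    proof -
      have "\<forall>\<^sub>F t in at 0. N j ((1 / t) *\<^sub>R (\<alpha> (axis j a) t $ j - axis j a $ j) - \<eta> (axis j a) $ j)
          = N j ((1 / t) *\<^sub>R (\<beta> a t - \<beta> a 0) - \<eta>\<^sub>j a)"
        using small by eventually_elim (simp only: \<beta>0, simp add: \<beta>_def c_id \<eta>\<^sub>j_def)
      from Lim_transform_eventually[OF _ this] der[OF ax] show ?thesis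
        by (simp add: norm_tendsto_def)
    qed
    show "N j (\<beta> a t - \<beta> b t) = N j (a - b)" if "b \<in> S j" for b t
      using near_identity_isometry.component_isometry[OF near_iso[OF c(1)] a that]
      by (simp add: \<beta>_def)
  qed
  then have "\<eta>\<^sub>j \<in> infinitesimal_rigid_motions (S j) (N j)"
    by (auto simp: infinitesimal_rigid_motions_def)
  moreover have "\<eta> x $ j = \<eta>\<^sub>j (x $ j)" if x: "x \<in> P" for x
  proof -
    let ?y = "axis j (x $ j)"
    let ?q = "\<lambda>t. (1 / t) *\<^sub>R (\<alpha> x t $ j - x $ j)"
    have y: "?y \<in> P" using x by simp
    have "\<forall>\<^sub>F t in at 0. N j ((1 / t) *\<^sub>R (\<alpha> ?y t $ j - ?y $ j) - \<eta> ?y $ j) = N j (?q t - \<eta> ?y $ j)"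
      using small
    proof eventually_elim
      case (elim t)
      have "\<alpha> ?y t $ j = \<alpha> x t $ j"
        using near_identity_isometry.component_dependence[OF near_iso[OF elim] y x] by simp
      then show ?case by simp
    qed
    from Lim_transform_eventually[OF _ this] der[OF y]
    have "((\<lambda>t. N j (?q t - \<eta> ?y $ j)) \<longlongrightarrow> 0) (at 0)" by (simp add: norm_tendsto_def)
    moreover have "((\<lambda>t. N j (?q t - \<eta> x $ j)) \<longlongrightarrow> 0) (at 0)"
      using der[OF x] by (simp add: norm_tendsto_def)
    ultimately have "((\<lambda>t. N j (?q t - \<eta> x $ j) + N j (?q t - \<eta> ?y $ j)) \<longlongrightarrow> 0 + 0) (at 0)"
      by (intro tendsto_add)
    moreover have "\<forall>\<^sub>F t in at 0. N j (\<eta> x $ j - \<eta> ?y $ j)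
        \<le> N j (?q t - \<eta> x $ j) + N j (?q t - \<eta> ?y $ j)"
      using small
    proof eventually_elim
      case (elim t)
      then have "\<alpha> x t \<in> P" using \<epsilon> by (intro \<alpha>P[OF x]) auto
      then have "?q t \<in> S j" using x by simp
      then show ?case
        using factor.norm_diff_triangle[of "\<eta> x $ j" j "?q t" "\<eta> ?y $ j"]
          factor.norm_diff_commute[of "\<eta> x $ j" j "?q t"] \<eta>P[OF x] \<eta>P[OF y] by simp
    qed
    ultimately have "N j (\<eta> x $ j - \<eta> ?y $ j) \<le> 0 + 0"
      by (intro tendsto_lowerbound[where F = "at (0::real)"]) auto
    then have "\<eta> x $ j - \<eta> ?y $ j = 0"
      using factor.norm_nonneg[of "\<eta> x $ j - \<eta> ?y $ j" j]
        factor.norm_eq_0[of "\<eta> x $ j - \<eta> ?y $ j" j] \<eta>P[OF x] \<eta>P[OF y] by simp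
    then show ?thesis by (simp add: \<eta>\<^sub>j_def)
  qed
  ultimately show thesis by (rule that)
qed

lemma infinitesimal_rigid_motion_prod:
  assumes "\<And>j. \<eta> j \<in> infinitesimal_rigid_motions (S j) (N j)"
  shows "(\<lambda>x. \<chi> j. \<eta> j (x $ j)) \<in> infinitesimal_rigid_motions P (prod_norm N)"
proof -
  obtain \<alpha> where \<alpha>: "\<And>j. rigid_motion (S j) (N j) (\<alpha> j) (\<eta> j)"
    using assms unfolding infinitesimal_rigid_motions_def by simp metis
  have "rigid_motion P (prod_norm N) (\<lambda>x t. \<chi> j. \<alpha> j (x $ j) t) (\<lambda>x. \<chi> j. \<eta> j (x $ j))"
    unfolding rigid_motion_def
  proof (intro conjI ballI)
    fix x assume x: "x \<in> P"
    then have xj: "x $ j \<in> S j" for j by simp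
    note * = \<alpha>[unfolded rigid_motion_def]
    show "(\<chi> j. \<alpha> j (x $ j) 0) = x" using * xj by (simp add: vec_eq_iff)
    show "(\<chi> j. \<eta> j (x $ j)) \<in> P" using * xj by (simp add: in_prod_iff)
    show "norm_tendsto (prod_norm N)
        (\<lambda>t. (1 / t) *\<^sub>R ((\<chi> j. \<alpha> j (x $ j) t) - (\<chi> j. \<alpha> j (x $ j) 0))) (\<chi> j. \<eta> j (x $ j)) (at 0)"
    proof (rule norm_tendsto_prod)
      fix j
      have "norm_tendsto (N j) (\<lambda>t. (1 / t) *\<^sub>R (\<alpha> j (x $ j) t - \<alpha> j (x $ j) 0)) (\<eta> j (x $ j)) (at 0)"
        using *[of j] xj[of j] by blast
      then show "norm_tendsto (N j) (\<lambda>t. ((1 / t) *\<^sub>R ((\<chi> j. \<alpha> j (x $ j) t)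
          - (\<chi> j. \<alpha> j (x $ j) 0))) $ j) ((\<chi> j. \<eta> j (x $ j)) $ j) (at 0)" by simp
    qed
    fix t :: real assume t: "t \<in> {-1..1}"
    show "(\<chi> j. \<alpha> j (x $ j) t) \<in> P" using * xj t by (simp add: in_prod_iff)
    show "norm_tendsto (prod_norm N) (\<lambda>t. \<chi> j. \<alpha> j (x $ j) t) (\<chi> j. \<alpha> j (x $ j) t)
        (at t within {-1..1})"
      using * xj t by (intro norm_tendsto_prod) simp
    fix y assume y: "y \<in> P"
    then have "y $ j \<in> S j" for j by simp
    then show "prod_norm N ((\<chi> j. \<alpha> j (x $ j) t) - (\<chi> j. \<alpha> j (y $ j) t)) = prod_norm N (x - y)"
      using * xj t by (simp add: prod_norm_def)
  qed
  then show ?thesis by (auto simp: infinitesimal_rigid_motions_def)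
qed

end

section \<open>Smooth points of the product norm and framework colours\<close>

context normed_product
begin

lemma smooth_dominant_component_unique:
  assumes smooth: "smooth_norm_at P (prod_norm N) u"
    and j: "prod_norm N u = N j (u $ j)" and k: "prod_norm N u = N k (u $ k)"
  shows "j = k"
proof (rule ccontr)
  assume "j \<noteq> k"
  have u: "u \<in> P" "u \<noteq> 0"
    and unique: "\<exists>!f. support_functional P (prod_norm N) ((1 / prod_norm N u) *\<^sub>R u) f"
    using smooth by (auto simp: smooth_norm_at_def)
  have pos: "0 < prod_norm N u"
    using prod.norm_nonneg[OF u(1)] prod.norm_eq_0[OF u(1)] u(2) by linarith
  \<comment> \<open>A support functional of a factor attaining the maximum supports the product norm at \<open>u\<close>. The ones
    for \<open>j\<close> and \<open>k\<close> differ at the vector with \<open>u $ j\<close> as its only nonzero component.\<close>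
  have support: "\<exists>f. linear f \<and> f (u $ i) = prod_norm N u \<and>
      support_functional P (prod_norm N) ((1 / prod_norm N u) *\<^sub>R u) (restrict (\<lambda>x. f (x $ i)) P)"
    if i: "prod_norm N u = N i (u $ i)" for i
  proof -
    have "u $ i \<noteq> 0" using i pos by auto
    then obtain f where f: "linear f" "f (u $ i) = N i (u $ i)"
      "\<And>x. x \<in> S i \<Longrightarrow> \<bar>f x\<bar> \<le> N i x"
      using factor.support_functional_exists[of "u $ i" i] u(1) by auto
    have "\<bar>f (x $ i)\<bar> \<le> prod_norm N x" if "x \<in> P" for x
      using f(3)[of "x $ i"] prod_norm_ge[of N i x] that by simp
    then have "support_functional P (prod_norm N) ((1 / prod_norm N u) *\<^sub>R u)
        (restrict (\<lambda>x. f (x $ i)) P)"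
      using f pos u(1) i by (auto simp: support_functional_def linear_add linear_cmul)
    with f i show ?thesis by auto
  qed
  obtain f g where f: "linear f" "f (u $ j) = prod_norm N u"
    and "support_functional P (prod_norm N) ((1 / prod_norm N u) *\<^sub>R u) (restrict (\<lambda>x. f (x $ j)) P)"
    and g: "linear g"
    and "support_functional P (prod_norm N) ((1 / prod_norm N u) *\<^sub>R u) (restrict (\<lambda>x. g (x $ k)) P)"
    using support[OF j] support[OF k] by blast
  with unique have "restrict (\<lambda>x. f (x $ j)) P = restrict (\<lambda>x. g (x $ k)) P" by blast
  from fun_cong[OF this, of "axis j (u $ j)"] have "f (u $ j) = g (axis j (u $ j) $ k)"
    using u(1) by simp
  also have "\<dots> = 0" using \<open>j \<noteq> k\<close> g by (simp add: axis_def linear_0)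
  finally show False using f(2) pos by simp
qed


lemma component_norm_tendsto:
  assumes u: "u \<in> P" and d: "d \<in> P"
  shows "((\<lambda>t. N k ((u + t *\<^sub>R d) $ k)) \<longlongrightarrow> N k (u $ k)) (at 0)"
proof (rule LIM_zero_cancel, rule Lim_null_comparison)
  have "((\<lambda>t. \<bar>t\<bar> * N k (d $ k)) \<longlongrightarrow> \<bar>0\<bar> * N k (d $ k)) (at (0::real))"
    by (intro tendsto_intros)
  then show "((\<lambda>t. \<bar>t\<bar> * N k (d $ k)) \<longlongrightarrow> 0) (at (0::real))" by simp
  have "\<bar>N k ((u + t *\<^sub>R d) $ k) - N k (u $ k)\<bar> \<le> \<bar>t\<bar> * N k (d $ k)" for t
    using factor.norm_triangle[of "u $ k" k "t *\<^sub>R d $ k"]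
      factor.norm_reverse_triangle[of "u $ k" k "t *\<^sub>R d $ k"] u d
    by (auto simp: factor.norm_scale)
  then show "\<forall>\<^sub>F t in at 0. norm (N k ((u + t *\<^sub>R d) $ k) - N k (u $ k)) \<le> \<bar>t\<bar> * N k (d $ k)"
    by simp
qed

lemma prod_norm_eventually_component:
  assumes u: "u \<in> P" and d: "d \<in> P"
    and dominant: "\<And>k. k \<noteq> j \<Longrightarrow> N k (u $ k) < N j (u $ j)"
  shows "\<forall>\<^sub>F t in at 0. prod_norm N (u + t *\<^sub>R d) = N j ((u + t *\<^sub>R d) $ j)"
proof -
  have "\<forall>\<^sub>F t in at 0. \<forall>k. k \<noteq> j \<longrightarrow> N k ((u + t *\<^sub>R d) $ k) < N j ((u + t *\<^sub>R d) $ j)"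
  proof (rule eventually_all_finite)
    fix k
    show "\<forall>\<^sub>F t in at 0. k \<noteq> j \<longrightarrow> N k ((u + t *\<^sub>R d) $ k) < N j ((u + t *\<^sub>R d) $ j)"
    proof (cases "k = j")
      case False
      have "((\<lambda>t. N j ((u + t *\<^sub>R d) $ j) - N k ((u + t *\<^sub>R d) $ k))
          \<longlongrightarrow> N j (u $ j) - N k (u $ k)) (at 0)"
        by (intro tendsto_diff component_norm_tendsto u d)
      from order_tendstoD(1)[OF this, of 0] dominant[OF False] show ?thesis
        by (auto elim: eventually_mono)
    qed simp
  qed
  then show ?thesis
    by eventually_elim (rule prod_norm_strictly_dominant, simp)
qed

end

section \<open>Flexes and rigidity, colour by colour\<close>

locale product_framework = normed_product S N
  for S :: "'n::finite \<Rightarrow> 'a::real_vector set" and N :: "'n \<Rightarrow> 'a \<Rightarrow> real" +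
  fixes V :: "'v set" and E :: "'v set set" and p :: "'v \<Rightarrow> 'a ^ 'n"
  assumes framework: "bar_joint_framework (prod_carrier S) V E p"
    and well_pos: "well_positioned (prod_carrier S) (prod_norm N) E p"
begin

abbreviation colour :: "'n \<Rightarrow> 'v set set" where "colour j \<equiv> colour_edges N E p j"

abbreviation rigid_colour :: "'n \<Rightarrow> bool" where
  "rigid_colour j \<equiv> infinitesimally_rigid (S j) (N j) V (colour j) (proj_placement p j)"

lemma placement_in: "v \<in> V \<Longrightarrow> p v \<in> P"
  using framework by (simp add: bar_joint_framework_def)

lemma edge_vertices: "{v, w} \<in> E \<Longrightarrow> v \<in> V \<and> w \<in> V"
  using framework unfolding bar_joint_framework_def finite_simple_graph_def by blast

lemma edge_doubleton:
  assumes "e \<in> E"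
  obtains v w where "e = {v, w}"
  using framework assms unfolding bar_joint_framework_def finite_simple_graph_def
  by (metis card_2_iff)

lemma remove_edge: "product_framework S N V (E - {e}) p"
  using framework well_pos
  by unfold_locales (auto simp: bar_joint_framework_def finite_simple_graph_def well_positioned_def)

lemma colour_edges_iff:
  "{v, w} \<in> colour j \<longleftrightarrow> {v, w} \<in> E \<and> prod_norm N (p v - p w) = N j ((p v - p w) $ j)"
proof
  assume "{v, w} \<in> colour j"
  then obtain a b where ab: "{v, w} = {a, b}" "{a, b} \<in> E"
    and c: "prod_norm N (p a - p b) = N j ((p a - p b) $ j)"
    unfolding colour_edges_def by blast
  have P: "p a \<in> P" "p b \<in> P" using edge_vertices[OF ab(2)] placement_in by auto
  then have "prod_norm N (p b - p a) = N j ((p b - p a) $ j)"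
    using c prod.norm_diff_commute[OF P] factor.norm_diff_commute[of "p a $ j" j "p b $ j"] by simp
  with ab c show "{v, w} \<in> E \<and> prod_norm N (p v - p w) = N j ((p v - p w) $ j)"
    by (metis doubleton_eq_iff)
qed (auto simp: colour_edges_def)

lemma edge_has_colour:
  assumes "e \<in> E"
  obtains j where "e \<in> colour j"
proof -
  obtain v w where "e = {v, w}" using edge_doubleton[OF assms] .
  with assms that colour_edges_iff prod_norm_attained[of N "p v - p w"] show thesis by blast
qed

lemma colour_unique:
  assumes "e \<in> colour j" "e \<in> colour k"
  shows "j = k"
proof -
  have "e \<in> E" using assms(1) by (auto simp: colour_edges_def)
  then obtain v w where e: "e = {v, w}" by (rule edge_doubleton)
  with \<open>e \<in> E\<close> well_pos have "smooth_norm_at P (prod_norm N) (p v - p w)"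
    by (auto simp: well_positioned_def)
  from smooth_dominant_component_unique[OF this, of j k] assms show ?thesis
    unfolding e colour_edges_iff by blast
qed

lemma flex_edge_iff:
  assumes e: "{v, w} \<in> colour j" and z: "z v \<in> P" "z w \<in> P"
  shows "((\<lambda>t. (1 / t) * (prod_norm N ((p v + t *\<^sub>R z v) - (p w + t *\<^sub>R z w)) -
            prod_norm N (p v - p w))) \<longlongrightarrow> 0) (at 0) \<longleftrightarrow>
         ((\<lambda>t. (1 / t) * (N j ((p v $ j + t *\<^sub>R z v $ j) - (p w $ j + t *\<^sub>R z w $ j)) -
            N j (p v $ j - p w $ j))) \<longlongrightarrow> 0) (at 0)"
proof (rule filterlim_cong[OF refl refl])
  let ?u = "p v - p w" and ?d = "z v - z w"
  have E: "{v, w} \<in> E" and j: "prod_norm N ?u = N j (?u $ j)"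
    using e by (simp_all add: colour_edges_iff)
  have u: "?u \<in> P" using edge_vertices[OF E] placement_in by simp
  have dominant: "N k (?u $ k) < N j (?u $ j)" if "k \<noteq> j" for k
  proof -
    have "prod_norm N ?u \<noteq> N k (?u $ k)"
      using colour_unique[OF e, of k] E that unfolding colour_edges_iff by blast
    with prod_norm_ge[of N k ?u] j show ?thesis by simp
  qed
  have split: "(p v + t *\<^sub>R z v) - (p w + t *\<^sub>R z w) = ?u + t *\<^sub>R ?d" for t
    by (simp add: algebra_simps)
  have near: "\<forall>\<^sub>F t in at 0. prod_norm N (?u + t *\<^sub>R ?d) = N j ((?u + t *\<^sub>R ?d) $ j)"
    using u z dominant by (intro prod_norm_eventually_component) auto
  show "\<forall>\<^sub>F t in at 0. (1 / t) * (prod_norm N ((p v + t *\<^sub>R z v) - (p w + t *\<^sub>R z w)) - prod_norm N ?u)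
      = (1 / t) * (N j ((p v $ j + t *\<^sub>R z v $ j) - (p w $ j + t *\<^sub>R z w $ j)) - N j (p v $ j - p w $ j))"
    using near unfolding split[symmetric] by eventually_elim (simp add: j)
qed

lemma infinitesimal_flex_iff:
  "infinitesimal_flex P (prod_norm N) V E p z \<longleftrightarrow>
     (\<forall>j. infinitesimal_flex (S j) (N j) V (colour j) (proj_placement p j) (\<lambda>v. z v $ j))"
  (is "?L \<longleftrightarrow> ?R")
proof -
  have carrier: "(\<forall>v\<in>V. z v \<in> P) \<longleftrightarrow> (\<forall>j. \<forall>v\<in>V. z v $ j \<in> S j)"
    by (auto simp: in_prod_iff)
  have edges: "(\<forall>v w. {v, w} \<in> E \<longrightarrow> Q v w) \<longleftrightarrow> (\<forall>j v w. {v, w} \<in> colour j \<longrightarrow> Q v w)" for Q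
    using edge_has_colour colour_edges_iff by metis
  show ?thesis
  proof (cases "\<forall>v\<in>V. z v \<in> P")
    case True
    then have "z v \<in> P \<and> z w \<in> P" if "{v, w} \<in> colour j" for v w j
      using that True edge_vertices colour_edges_iff by blast
    then show ?thesis
      using True carrier flex_edge_iff[of _ _ _ z]
      unfolding infinitesimal_flex_def edges proj_placement_def by (simp cong: imp_cong)
  next
    case False
    then show ?thesis using carrier unfolding infinitesimal_flex_def by metis
  qed
qed

text \<open>
  For the forward direction a flex of one monochrome subframework is extended by zero to the other
  factors; the motion that makes it trivial is then projected back.
\<close>
lemma infinitesimally_rigid_iff:
  "infinitesimally_rigid P (prod_norm N) V E p \<longleftrightarrow> (\<forall>j. rigid_colour j)"
proof
  assume rigid: "infinitesimally_rigid P (prod_norm N) V E p"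
  show "\<forall>j. rigid_colour j"
    unfolding infinitesimally_rigid_def
  proof (intro allI impI)
    fix j z
    assume z: "infinitesimal_flex (S j) (N j) V (colour j) (proj_placement p j) z"
    have "infinitesimal_flex (S k) (N k) V (colour k) (proj_placement p k) (\<lambda>v. axis j (z v) $ k)" for k
      using z by (cases "k = j") (auto simp: axis_def infinitesimal_flex_def)
    then have "infinitesimal_flex P (prod_norm N) V E p (\<lambda>v. axis j (z v))"
      by (simp add: infinitesimal_flex_iff)
    with rigid obtain \<eta> where \<eta>: "\<eta> \<in> infinitesimal_rigid_motions P (prod_norm N)"
      and z\<eta>: "\<And>v. v \<in> V \<Longrightarrow> axis j (z v) = \<eta> (p v)"
      unfolding infinitesimally_rigid_def trivial_flex_def by blast
    obtain \<eta>\<^sub>j where \<eta>\<^sub>j: "\<eta>\<^sub>j \<in> infinitesimal_rigid_motions (S j) (N j)"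
      "\<And>x. x \<in> P \<Longrightarrow> \<eta> x $ j = \<eta>\<^sub>j (x $ j)"
      using infinitesimal_rigid_motion_components[OF \<eta>, of j] by blast
    have "z v = \<eta>\<^sub>j (proj_placement p j v)" if "v \<in> V" for v
    proof -
      have "z v = axis j (z v) $ j" by simp
      also have "\<dots> = \<eta>\<^sub>j (p v $ j)"
        unfolding z\<eta>[OF that] by (rule \<eta>\<^sub>j(2)[OF placement_in[OF that]])
      finally show ?thesis by (simp add: proj_placement_def)
    qed
    with \<eta>\<^sub>j(1) show "trivial_flex (S j) (N j) V (proj_placement p j) z"
      by (auto simp: trivial_flex_def)
  qed
next
  assume rigid: "\<forall>j. rigid_colour j"
  show "infinitesimally_rigid P (prod_norm N) V E p"
    unfolding infinitesimally_rigid_def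
  proof (intro allI impI)
    fix z assume "infinitesimal_flex P (prod_norm N) V E p z"
    then have "trivial_flex (S j) (N j) V (proj_placement p j) (\<lambda>v. z v $ j)" for j
      using rigid by (simp add: infinitesimal_flex_iff infinitesimally_rigid_def)
    then obtain \<eta> where \<eta>: "\<And>j. \<eta> j \<in> infinitesimal_rigid_motions (S j) (N j)"
      and z: "\<And>j v. v \<in> V \<Longrightarrow> z v $ j = \<eta> j (p v $ j)"
      unfolding trivial_flex_def proj_placement_def by metis
    from infinitesimal_rigid_motion_prod[of \<eta>, OF \<eta>] show "trivial_flex P (prod_norm N) V p z"
      unfolding trivial_flex_def by (rule bexI[rotated]) (simp add: vec_eq_iff z)
  qed
qed

lemma minimally_infinitesimally_rigid_iff:
  "minimally_infinitesimally_rigid P (prod_norm N) V E p \<longleftrightarrow>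
     (\<forall>j. minimally_infinitesimally_rigid (S j) (N j) V (colour j) (proj_placement p j))"
proof -
  have minus: "infinitesimally_rigid P (prod_norm N) V (E - {e}) p \<longleftrightarrow>
      (\<forall>j. infinitesimally_rigid (S j) (N j) V (colour j - {e}) (proj_placement p j))" for e
  proof -
    have "colour_edges N (E - {e}) p j = colour j - {e}" for j by (auto simp: colour_edges_def)
    then show ?thesis using product_framework.infinitesimally_rigid_iff[OF remove_edge, of e] by simp
  qed
  \<comment> \<open>Deleting an edge changes only the subgraph of its own colour.\<close>
  have "infinitesimally_rigid P (prod_norm N) V (E - {e}) p \<longleftrightarrow>
      infinitesimally_rigid (S j) (N j) V (colour j - {e}) (proj_placement p j)"
    if rigid: "\<forall>j. rigid_colour j" and e: "e \<in> colour j" for e j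
  proof -
    have "colour k - {e} = colour k" if "k \<noteq> j" for k using colour_unique[OF e] that by blast
    then show ?thesis unfolding minus using rigid by metis
  qed
  moreover have "e \<in> E" if "e \<in> colour j" for e j using that by (auto simp: colour_edges_def)
  ultimately show ?thesis
    unfolding minimally_infinitesimally_rigid_def infinitesimally_rigid_iff
    by (metis edge_has_colour)
qed

end

theorem theorem4p11:
  fixes S :: "'n::finite \<Rightarrow> 'a::real_vector set"
    and N :: "'n \<Rightarrow> 'a \<Rightarrow> real"
    and V :: "'v set" and E :: "'v set set"
    and p :: "'v \<Rightarrow> 'a ^ 'n"
  assumes "\<And>j. finite_dim_normed_space_on (S j) (N j)"
    and "bar_joint_framework (prod_carrier S) V E p"
    and "well_positioned (prod_carrier S) (prod_norm N) E p"
  shows "(infinitesimally_rigid (prod_carrier S) (prod_norm N) V E p \<longleftrightarrow>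
            (\<forall>j. infinitesimally_rigid (S j) (N j) V (colour_edges N E p j) (proj_placement p j)))
       \<and> (minimally_infinitesimally_rigid (prod_carrier S) (prod_norm N) V E p \<longleftrightarrow>
            (\<forall>j. minimally_infinitesimally_rigid (S j) (N j) V
                   (colour_edges N E p j) (proj_placement p j)))"
proof -
  interpret product_framework S N V E p
    using assms by unfold_locales
  show ?thesis using infinitesimally_rigid_iff minimally_infinitesimally_rigid_iff ..
qed

end
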